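(* Let $\mathcal L$ be a finite relational language of maximum arity $r\ge2$ and let $0<\epsilon<1$. For all integers $k\ge r$ there are a positive constant $c=c(k,r,\mathcal L,\epsilon)$ and $m=m(k,r)>1$ such that for all sufficiently large $n$ the following holds. Suppose $\mathcal F$ is a collection of finite $\mathcal L$-structures, each of size at most $k$, and $\mathcal H:=\mathrm{Forb}(\mathcal F)\ne\emptyset$. For any set $W$ of size $n$, there is a set $\Sigma\subseteq\mathcal P(S_r(C_W,\mathcal H))$ such that the following hold. 1. For every $\mathcal F$-free $\mathcal L$-structure $M$ with domain $W$, there is $\sigma\in\Sigma$ such that $Diag^{tp}(M)\subseteq\sigma$. 2. For all $\sigma\in\Sigma$: for each $1\le\ell\le k$, $|Diag^{tp}(\mathcal F(\ell),C_W)\cap Span(\sigma)|\le\epsilon\binom n\ell$, and for each $r+1\le\ell\le2r$, $|Err_\ell(C_W)\cap Span(\sigma)|\le\epsilon\binom n\ell$. 3. $\log|\Sigma|\le cn^{r-\frac1m}\log n$.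
   Context: $\mathcal L$ is a finite relational first-order language with maximum arity $r\ge2$. All formulas and types are quantifier-free. The size of a structure is the cardinality of its domain. $\mathcal P(X)$ is the power set of $X$. An $\mathcal L$-structure is $\mathcal F$-free if no (induced) substructure of it is isomorphic to an element of $\mathcal F$; $\mathrm{Forb}(\mathcal F)$ is the class of all finite $\mathcal F$-free $\mathcal L$-structures; $\mathcal F(\ell)$ is the collection of elements of $\mathcal F$ of size exactly $\ell$. $S_r(\mathcal L)$ is the set of all complete quantifier-free $r$-types $p(x_1,\dots,x_r)$ that are proper (contain $x_i\neq x_j$ for all $i\ne j$); $S_r(\mathcal H)$ is the set of those realized in some element of $\mathcal H$. For a set $C$ of constant symbols, $S_r(C)=\{p(\bar c):p\in S_r(\mathcal L),\ \bar c\in C^{\underline r}\}$ and $S_r(C,\mathcal H)=\{p(\bar c):p\in S_r(\mathcal H),\ \bar c\in C^{\underline r}\}$, where $C^{\underline r}$ is the set of $r$-tuples of pairwise distinct elements of $C$ and $p(\bar c)$ is the set of sentences obtained by substituting $c_i$ for $x_i$. For a set $W$, $C_W=\{c_w:w\in W\}$ is a set of constant symbols. For $\sigma\subseteq S_r(C)$: $V(\sigma)$ is the set of constants of $C$ appearing in some element of $\sigma$; for an $r$-element $A\subseteq V(\sigma)$, $Ch_\sigma(A)$ is the set of $p(\bar c)\in\sigma$ whose set of constants is $A$. $\sigma$ is a syntactic $m$-diagram if $|V(\sigma)|=m$ and $|Ch_\sigma(A)|=1$ for every $r$-element subset $A$ of $V(\sigma)$; $\sigma$ is a syntactic type diagram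 if it is a syntactic $|V(\sigma)|$-diagram. For an $\mathcal L\cup V(\sigma)$-structure $N$, $N\models\sigma^N$ means $N\models p(\bar c^N)$ for all $p(\bar c)\in\sigma$. $\sigma$ is satisfiable if some $\mathcal L\cup V(\sigma)$-structure $N$ has $N\models\sigma^N$; for a collection $\mathcal A$ of finite $\mathcal L$-structures, $\sigma$ is $\mathcal A$-satisfiable if there is an $\mathcal L\cup V(\sigma)$-structure $N$ with $N\models\sigma^N$ whose $\mathcal L$-reduct is in $\mathcal A$. $Diag^{tp}(\mathcal A,C)$ is the set of syntactic type diagrams $\sigma\subseteq S_r(C)$ which are $\mathcal A$-satisfiable. (In these definitions $\mathcal A$ may be taken to be closed under isomorphism.) $Span(\sigma)=\{\sigma'\subseteq\sigma:\sigma'\text{ is a syntactic type diagram}\}$. $Err_\ell(C)$ is the set of unsatisfiable syntactic $\ell$-diagrams $\sigma\subseteq S_r(C)$. For an $\mathcal L$-structure $M$ with domain $W$, $Diag^{tp}(M)=\{p(c_{\bar a})\in S_r(C_W):M\models p(\bar a)\}$, where $c_{\bar a}=(c_{a_1},\dots,c_{a_r})$. *)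

theory Defs
  imports Complex_Main
begin

record 'f lang =
  symb :: "'f set"
  arity :: "'f \<Rightarrow> nat"

definition rel_lang :: "nat \<Rightarrow> 'f lang \<Rightarrow> bool" where
  "rel_lang r L \<longleftrightarrow> finite (symb L) \<and> symb L \<noteq> {} \<and> (\<forall>R\<in>symb L. 1 \<le> arity L R)
     \<and> Max (arity L ` symb L) = r"

record ('f, 'a) struc =
  univ :: "'a set"
  rel :: "'f \<Rightarrow> 'a list set"

text \<open>Domains are nonempty. The values of \<open>rel\<close> outside \<open>symb L\<close> are irrelevant to
  everything below.\<close>

definition is_struc :: "'f lang \<Rightarrow> ('f, 'a) struc \<Rightarrow> bool" where
  "is_struc L M \<longleftrightarrow> univ M \<noteq> {} \<and>
     (\<forall>R\<in>symb L. rel M R \<subseteq> {xs. length xs = arity L R \<and> set xs \<subseteq> univ M})"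

definition substruc :: "'f lang \<Rightarrow> ('f, 'a) struc \<Rightarrow> ('f, 'a) struc \<Rightarrow> bool" where
  "substruc L N M \<longleftrightarrow> is_struc L N \<and> univ N \<subseteq> univ M \<and>
     (\<forall>R\<in>symb L. rel N R = {xs \<in> rel M R. set xs \<subseteq> univ N})"

definition isomorphic :: "'f lang \<Rightarrow> ('f, 'a) struc \<Rightarrow> ('f, 'b) struc \<Rightarrow> bool" where
  "isomorphic L M N \<longleftrightarrow> (\<exists>f. bij_betw f (univ M) (univ N) \<and>
     (\<forall>R\<in>symb L. \<forall>xs. length xs = arity L R \<and> set xs \<subseteq> univ M \<longrightarrow>
        (xs \<in> rel M R \<longleftrightarrow> map f xs \<in> rel N R)))"

definition is_free :: "'f lang \<Rightarrow> ('f, 'b) struc set \<Rightarrow> ('f, 'a) struc \<Rightarrow> bool" where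
  "is_free L \<F> M \<longleftrightarrow> \<not> (\<exists>N. substruc L N M \<and> (\<exists>A\<in>\<F>. isomorphic L N A))"

definition Forb :: "'f lang \<Rightarrow> ('f, 'b) struc set \<Rightarrow> ('f, 'a) struc set" where
  "Forb L \<F> = {M. is_struc L M \<and> finite (univ M) \<and> is_free L \<F> M}"

definition of_size :: "('f, 'a) struc set \<Rightarrow> nat \<Rightarrow> ('f, 'a) struc set" where
  "of_size \<F> l = {A \<in> \<F>. finite (univ A) \<and> card (univ A) = l}"


text \<open>Quantifier-free formulas with terms taken from \<open>'a\<close>. Formulas in the variables
  \<open>x\<^sub>1, \<dots>, x\<^sub>r\<close> have terms \<open>0, \<dots>, r - 1 :: nat\<close>; sentences over a set \<open>C\<close> of
  constants have terms from \<open>C\<close>. Substitution is \<open>map_qf id\<close>. The constant \<open>c\<^sub>w\<close> is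
  represented by \<open>w\<close> itself, so that \<open>C\<^sub>W\<close> is \<open>W\<close>.\<close>

datatype ('f, qf_terms: 'a) qf =
    Eq 'a 'a
  | Rel 'f "'a list"
  | Neg "('f, 'a) qf"
  | Conj "('f, 'a) qf" "('f, 'a) qf"
  for map: map_qf

primrec well_formed :: "'f lang \<Rightarrow> ('f, 'a) qf \<Rightarrow> bool" where
  "well_formed L (Eq s t) \<longleftrightarrow> True"
| "well_formed L (Rel R ts) \<longleftrightarrow> R \<in> symb L \<and> length ts = arity L R"
| "well_formed L (Neg \<phi>) \<longleftrightarrow> well_formed L \<phi>"
| "well_formed L (Conj \<phi> \<psi>) \<longleftrightarrow> well_formed L \<phi> \<and> well_formed L \<psi>"

definition formulas :: "'f lang \<Rightarrow> 'a set \<Rightarrow> ('f, 'a) qf set" where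
  "formulas L X = {\<phi>. well_formed L \<phi> \<and> qf_terms \<phi> \<subseteq> X}"

primrec sat :: "('f, 'a) struc \<Rightarrow> ('t \<Rightarrow> 'a) \<Rightarrow> ('f, 't) qf \<Rightarrow> bool" where
  "sat M v (Eq s t) \<longleftrightarrow> v s = v t"
| "sat M v (Rel R ts) \<longleftrightarrow> map v ts \<in> rel M R"
| "sat M v (Neg \<phi>) \<longleftrightarrow> \<not> sat M v \<phi>"
| "sat M v (Conj \<phi> \<psi>) \<longleftrightarrow> sat M v \<phi> \<and> sat M v \<psi>"

definition realizes :: "('f, 'a) struc \<Rightarrow> 'a list \<Rightarrow> ('f, nat) qf set \<Rightarrow> bool" where
  "realizes M as p \<longleftrightarrow> set as \<subseteq> univ M \<and> (\<forall>\<phi>\<in>p. sat M (\<lambda>i. as ! i) \<phi>)"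

text \<open>Here and in \<open>satisfiable\<close> below, structures are searched for with domain contained
  in \<open>nat\<close>. This loses no generality when only finitely many terms occur: restrict to the
  finite substructure on their interpretations.\<close>

definition complete_type :: "'f lang \<Rightarrow> nat \<Rightarrow> ('f, nat) qf set \<Rightarrow> bool" where
  "complete_type L r p \<longleftrightarrow> p \<subseteq> formulas L {..<r} \<and>
     (\<forall>\<phi> \<in> formulas L {..<r}. \<phi> \<in> p \<or> Neg \<phi> \<in> p) \<and>
     (\<exists>(N :: ('f, nat) struc) as. is_struc L N \<and> length as = r \<and> realizes N as p)"

definition proper_type :: "nat \<Rightarrow> ('f, nat) qf set \<Rightarrow> bool" where
  "proper_type r p \<longleftrightarrow> (\<forall>i<r. \<forall>j<r. i \<noteq> j \<longrightarrow> Neg (Eq i j) \<in> p)"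

definition types :: "'f lang \<Rightarrow> nat \<Rightarrow> ('f, nat) qf set set" where
  "types L r = {p. complete_type L r p \<and> proper_type r p}"

definition types_in :: "'f lang \<Rightarrow> nat \<Rightarrow> ('f, 'a) struc set \<Rightarrow> ('f, nat) qf set set" where
  "types_in L r \<H> = {p \<in> types L r. \<exists>N\<in>\<H>. \<exists>as. length as = r \<and> realizes N as p}"

definition tuples :: "nat \<Rightarrow> 'c set \<Rightarrow> 'c list set" where
  "tuples r C = {cs. length cs = r \<and> distinct cs \<and> set cs \<subseteq> C}"

definition inst :: "('f, nat) qf set \<Rightarrow> 'c list \<Rightarrow> ('f, 'c) qf set" where
  "inst p cs = map_qf id (\<lambda>i. cs ! i) ` p"

definition S_types :: "'f lang \<Rightarrow> nat \<Rightarrow> 'c set \<Rightarrow> ('f, 'c) qf set set" where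
  "S_types L r C = {inst p cs | p cs. p \<in> types L r \<and> cs \<in> tuples r C}"

definition S_types_in :: "'f lang \<Rightarrow> nat \<Rightarrow> 'c set \<Rightarrow> ('f, 'a) struc set \<Rightarrow> ('f, 'c) qf set set" where
  "S_types_in L r C \<H> = {inst p cs | p cs. p \<in> types_in L r \<H> \<and> cs \<in> tuples r C}"

definition consts_of :: "('f, 'c) qf set \<Rightarrow> 'c set" where
  "consts_of P = (\<Union>\<phi>\<in>P. qf_terms \<phi>)"

definition V_set :: "('f, 'c) qf set set \<Rightarrow> 'c set" where
  "V_set \<sigma> = (\<Union>P\<in>\<sigma>. consts_of P)"

definition Ch :: "('f, 'c) qf set set \<Rightarrow> 'c set \<Rightarrow> ('f, 'c) qf set set" where
  "Ch \<sigma> A = {P \<in> \<sigma>. consts_of P = A}"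

definition syntactic_diagram :: "'f lang \<Rightarrow> nat \<Rightarrow> 'c set \<Rightarrow> nat \<Rightarrow> ('f, 'c) qf set set \<Rightarrow> bool" where
  "syntactic_diagram L r C m \<sigma> \<longleftrightarrow> \<sigma> \<subseteq> S_types L r C \<and> finite (V_set \<sigma>) \<and> card (V_set \<sigma>) = m \<and>
     (\<forall>A. A \<subseteq> V_set \<sigma> \<and> card A = r \<longrightarrow> card (Ch \<sigma> A) = 1)"

definition syntactic_type_diagram :: "'f lang \<Rightarrow> nat \<Rightarrow> 'c set \<Rightarrow> ('f, 'c) qf set set \<Rightarrow> bool" where
  "syntactic_type_diagram L r C \<sigma> \<longleftrightarrow> syntactic_diagram L r C (card (V_set \<sigma>)) \<sigma>"

text \<open>An expansion of \<open>N\<close> by the constants in \<open>V_set \<sigma>\<close> is given by a map \<open>v\<close> interpreting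
  the constants.\<close>

definition models :: "('f, 'a) struc \<Rightarrow> ('c \<Rightarrow> 'a) \<Rightarrow> ('f, 'c) qf set set \<Rightarrow> bool" where
  "models N v \<sigma> \<longleftrightarrow> v ` V_set \<sigma> \<subseteq> univ N \<and> (\<forall>P\<in>\<sigma>. \<forall>\<phi>\<in>P. sat N v \<phi>)"

definition satisfiable :: "'f lang \<Rightarrow> ('f, 'c) qf set set \<Rightarrow> bool" where
  "satisfiable L \<sigma> \<longleftrightarrow> (\<exists>(N :: ('f, nat) struc) v. is_struc L N \<and> models N v \<sigma>)"

text \<open>Closing \<open>\<A>\<close> under isomorphism does not change this notion, since \<open>v\<close> can be
  transported along an isomorphism.\<close>

definition satisfiable_in :: "('f, 'a) struc set \<Rightarrow> ('f, 'c) qf set set \<Rightarrow> bool" where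
  "satisfiable_in \<A> \<sigma> \<longleftrightarrow> (\<exists>N\<in>\<A>. \<exists>v. models N v \<sigma>)"

definition Diag_tp :: "'f lang \<Rightarrow> nat \<Rightarrow> ('f, 'a) struc set \<Rightarrow> 'c set \<Rightarrow> ('f, 'c) qf set set set" where
  "Diag_tp L r \<A> C = {\<sigma>. syntactic_type_diagram L r C \<sigma> \<and> satisfiable_in \<A> \<sigma>}"

definition Span :: "'f lang \<Rightarrow> nat \<Rightarrow> 'c set \<Rightarrow> ('f, 'c) qf set set \<Rightarrow> ('f, 'c) qf set set set" where
  "Span L r C \<sigma> = {\<tau>. \<tau> \<subseteq> \<sigma> \<and> syntactic_type_diagram L r C \<tau>}"

definition Err :: "'f lang \<Rightarrow> nat \<Rightarrow> nat \<Rightarrow> 'c set \<Rightarrow> ('f, 'c) qf set set set" where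
  "Err L r l C = {\<sigma>. syntactic_diagram L r C l \<sigma> \<and> \<not> satisfiable L \<sigma>}"

definition diagram_of :: "'f lang \<Rightarrow> nat \<Rightarrow> ('f, 'w) struc \<Rightarrow> ('f, 'w) qf set set" where
  "diagram_of L r M = {inst p as | p as. p \<in> types L r \<and> as \<in> tuples r (univ M) \<and> realizes M as p}"

end

theory Submission
  imports Defs
begin

text \<open>
  Every diagram on \<open>l\<close> constants is a set of exactly \<open>l choose r\<close> elements of \<open>S_types L r W\<close>,
  one for each set of \<open>r\<close> constants. Take the elements of \<open>S_types_in\<close> as vertices, and as edges the
  diagrams on \<open>l\<close> constants that describe a member of \<open>\<F>\<close> of size \<open>l\<close>, or that are unsatisfiable.
  This gives one uniform hypergraph for each \<open>l\<close> and each of the two kinds. The diagram of an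
  \<open>\<F>\<close>-free structure on \<open>W\<close> contains no edge of any of them: an edge of the first kind inside it
  would exhibit a forbidden substructure (\<open>diagram_of_free_avoids\<close>), and an edge of the second kind
  would be satisfied by the structure itself (\<open>diagram_of_satisfiable\<close>). So the assertion is a
  statement about containers for independent sets, for finitely many hypergraphs simultaneously.

  The exponent \<open>m\<close> may depend on \<open>k\<close> and \<open>r\<close> in any way, so a weak container theorem is enough, one
  that only sees degrees and the codegrees of pairs of vertices. A vertex fixes \<open>r\<close> constants, so it
  lies in \<open>O(n ^ (l - r))\<close> diagrams; two distinct vertices of one diagram involve at least \<open>r + 1\<close>
  constants, so they lie together in \<open>O(n ^ (l - r - 1))\<close> diagrams. Pairs thus gain a factor \<open>n\<close>
  (\<open>hypergraph_of_diagrams\<close>), which the container theorem turns into fingerprints of about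
  \<open>n powr (r - 1 / m)\<close> vertices.

  The container theorem goes by induction on the uniformity (\<open>container_step\<close>,
  \<open>containers_one_round\<close>). Given an independent set \<open>I\<close> in a dense \<open>(s + 1)\<close>-uniform hypergraph,
  repeatedly choose a vertex of \<open>I\<close> of large degree, and collect its link. Either this is impossible
  at some moment, and then \<open>I\<close> lies inside the set of vertices of small degree, whose complement has
  size of order \<open>N\<close>; or after \<open>q\<close> choices the collected links form a dense \<open>s\<close>-uniform hypergraph in
  which \<open>I\<close> is again independent. Degrees in the new hypergraph are kept under control by discarding
  the edges through vertices that are already saturated, and codegrees do not grow at all, since every
  edge contributes to at most one link. Only the chosen vertices need to be remembered, which bounds the
  number of containers. Each round removes a fixed proportion of the \<open>N\<close> vertices, so a bounded
  number of rounds makes every container sparse in all hypergraphs (\<open>containers_for_hypergraphs\<close>).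

  Finally, a diagram that is satisfiable in a structure of size \<open>l\<close> may have fewer than \<open>l\<close>
  constants. There are only \<open>O(n ^ (l - 1))\<close> of these, which is negligible against \<open>n choose l\<close>
  (\<open>few_diagrams_of_forbidden\<close>).
\<close>

section \<open>Families of containers\<close>

definition star :: "'e set \<Rightarrow> ('e \<Rightarrow> 'v set) \<Rightarrow> 'v \<Rightarrow> 'e set" where
  "star E \<phi> u = {e \<in> E. u \<in> \<phi> e}"

text \<open>Edges are indexed by \<open>E\<close> through \<open>\<phi>\<close>, so distinct indices may carry the same vertex set. The links
collected below are multi-hypergraphs, and they inherit their indices from the original edges.\<close>

definition hypergraph ::
  "'v set \<Rightarrow> 'e set \<Rightarrow> ('e \<Rightarrow> 'v set) \<Rightarrow> nat \<Rightarrow> real \<Rightarrow> real \<Rightarrow> bool" where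
  "hypergraph V E \<phi> s D B \<longleftrightarrow> finite V \<and> finite E \<and> (\<forall>e\<in>E. \<phi> e \<subseteq> V \<and> card (\<phi> e) = s) \<and>
     (\<forall>u\<in>V. real (card (star E \<phi> u)) \<le> D) \<and>
     (\<forall>u\<in>V. \<forall>w\<in>V. u \<noteq> w \<longrightarrow> real (card (star E \<phi> u \<inter> star E \<phi> w)) \<le> B)"

definition edge_free :: "'e set \<Rightarrow> ('e \<Rightarrow> 'v set) \<Rightarrow> 'v set \<Rightarrow> bool" where
  "edge_free E \<phi> I \<longleftrightarrow> (\<forall>e\<in>E. \<not> \<phi> e \<subseteq> I)"

text \<open>Only the number of containers matters below, so they are presented as a bare family.
Here \<open>P\<close> selects the sets to be contained and \<open>Q\<close> is the property demanded of each container.\<close>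

definition has_containers ::
  "'v set \<Rightarrow> ('v set \<Rightarrow> bool) \<Rightarrow> ('v set \<Rightarrow> bool) \<Rightarrow> real \<Rightarrow> bool" where
  "has_containers V P Q b \<longleftrightarrow> (\<exists>\<C>. finite \<C> \<and> real (card \<C>) \<le> b \<and>
     (\<forall>C\<in>\<C>. C \<subseteq> V \<and> Q C) \<and> (\<forall>I. I \<subseteq> V \<and> P I \<longrightarrow> (\<exists>C\<in>\<C>. I \<subseteq> C)))"

lemma has_containersI:
  assumes "finite \<C>" "real (card \<C>) \<le> b" "\<And>C. C \<in> \<C> \<Longrightarrow> C \<subseteq> V \<and> Q C"
    "\<And>I. I \<subseteq> V \<Longrightarrow> P I \<Longrightarrow> \<exists>C\<in>\<C>. I \<subseteq> C"
  shows "has_containers V P Q b"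
  unfolding has_containers_def by (intro exI[of _ \<C>]) (simp add: assms)

lemma has_containers_mono:
  assumes "has_containers V P Q b" "V \<subseteq> V'" "b \<le> b'"
    "\<And>C. C \<subseteq> V \<Longrightarrow> Q C \<Longrightarrow> Q' C" "\<And>I. I \<subseteq> V' \<Longrightarrow> P' I \<Longrightarrow> I \<subseteq> V \<and> P I"
  shows "has_containers V' P' Q' b'"
proof -
  obtain \<C> where c: "finite \<C>" "real (card \<C>) \<le> b" "\<forall>C\<in>\<C>. C \<subseteq> V \<and> Q C"
    "\<forall>I. I \<subseteq> V \<and> P I \<longrightarrow> (\<exists>C\<in>\<C>. I \<subseteq> C)"
    using assms(1) unfolding has_containers_def by blast
  show ?thesis
  proof (rule has_containersI[of \<C>])
    show "\<exists>C\<in>\<C>. I \<subseteq> C" if "I \<subseteq> V'" "P' I" for I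
      using c(4) assms(5)[OF that] by blast
    show "C \<subseteq> V' \<and> Q' C" if "C \<in> \<C>" for C
      using that c(3) assms(2,4) by (meson subset_trans)
  qed (use c(1,2) assms(3) in auto)
qed

lemma has_containers_Union:
  assumes "finite J" "\<And>j. j \<in> J \<Longrightarrow> has_containers V (P j) Q b"
    "\<And>I. I \<subseteq> V \<Longrightarrow> P' I \<Longrightarrow> \<exists>j\<in>J. P j I"
  shows "has_containers V P' Q (real (card J) * b)"
proof -
  have "\<forall>j\<in>J. \<exists>\<C>. finite \<C> \<and> real (card \<C>) \<le> b \<and>
     (\<forall>C\<in>\<C>. C \<subseteq> V \<and> Q C) \<and> (\<forall>I. I \<subseteq> V \<and> P j I \<longrightarrow> (\<exists>C\<in>\<C>. I \<subseteq> C))"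
    using assms(2) unfolding has_containers_def by simp
  from bchoice[OF this] obtain \<C> where \<C>: "\<forall>j\<in>J. finite (\<C> j) \<and> real (card (\<C> j)) \<le> b \<and>
     (\<forall>C\<in>\<C> j. C \<subseteq> V \<and> Q C) \<and> (\<forall>I. I \<subseteq> V \<and> P j I \<longrightarrow> (\<exists>C\<in>\<C> j. I \<subseteq> C))" ..
  then have c: "\<And>j. j \<in> J \<Longrightarrow> finite (\<C> j)" "\<And>j. j \<in> J \<Longrightarrow> real (card (\<C> j)) \<le> b"
    "\<And>j C. j \<in> J \<Longrightarrow> C \<in> \<C> j \<Longrightarrow> C \<subseteq> V \<and> Q C"
    "\<And>j I. j \<in> J \<Longrightarrow> I \<subseteq> V \<Longrightarrow> P j I \<Longrightarrow> (\<exists>C\<in>\<C> j. I \<subseteq> C)"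
    by simp_all
  show ?thesis
  proof (rule has_containersI[of "\<Union>j\<in>J. \<C> j"])
    have "real (card (\<Union>j\<in>J. \<C> j)) \<le> (\<Sum>j\<in>J. real (card (\<C> j)))"
      using card_UN_le[OF assms(1), of \<C>] of_nat_mono by fastforce
    also have "\<dots> \<le> real (card J) * b"
      using sum_bounded_above[of J "\<lambda>j. real (card (\<C> j))" b] c(2) by simp
    finally show "real (card (\<Union>j\<in>J. \<C> j)) \<le> real (card J) * b" .
    show "\<exists>C\<in>(\<Union>j\<in>J. \<C> j). I \<subseteq> C" if I: "I \<subseteq> V" "P' I" for I
    proof -
      obtain j where j: "j \<in> J" "P j I" using assms(3)[OF I] by (rule bexE)
      show ?thesis using c(4)[OF j(1) I(1) j(2)] j(1) by blast
    qed
    show "C \<subseteq> V \<and> Q C" if "C \<in> (\<Union>j\<in>J. \<C> j)" for C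
      using that by (elim UN_E) (rule c(3))
    show "finite (\<Union>j\<in>J. \<C> j)" using assms(1) c(1) by (rule finite_UN_I)
  qed
qed

lemma has_containers_disj:
  assumes "has_containers V P1 Q b1" "has_containers V P2 Q b2"
    "\<And>I. I \<subseteq> V \<Longrightarrow> P' I \<Longrightarrow> P1 I \<or> P2 I"
  shows "has_containers V P' Q (b1 + b2)"
proof -
  obtain \<C> where c: "finite \<C>" "real (card \<C>) \<le> b1" "\<forall>C\<in>\<C>. C \<subseteq> V \<and> Q C"
    "\<forall>I. I \<subseteq> V \<and> P1 I \<longrightarrow> (\<exists>C\<in>\<C>. I \<subseteq> C)"
    using assms(1) unfolding has_containers_def by blast
  obtain \<D> where d: "finite \<D>" "real (card \<D>) \<le> b2" "\<forall>C\<in>\<D>. C \<subseteq> V \<and> Q C"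
    "\<forall>I. I \<subseteq> V \<and> P2 I \<longrightarrow> (\<exists>C\<in>\<D>. I \<subseteq> C)"
    using assms(2) unfolding has_containers_def by blast
  show ?thesis
  proof (rule has_containersI[of "\<C> \<union> \<D>"])
    show "finite (\<C> \<union> \<D>)" using c(1) d(1) by simp
    show "real (card (\<C> \<union> \<D>)) \<le> b1 + b2"
      using card_Un_le[of \<C> \<D>] c(2) d(2) by linarith
    show "C \<subseteq> V \<and> Q C" if "C \<in> \<C> \<union> \<D>" for C
      using that by (rule UnE) (simp_all add: c(3) d(3))
    show "\<exists>C\<in>\<C> \<union> \<D>. I \<subseteq> C" if I: "I \<subseteq> V" "P' I" for I
      using assms(3)[OF I]
    proof
      assume "P1 I"
      then have "\<exists>C\<in>\<C>. I \<subseteq> C" using c(4) I(1) by simp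
      then show ?thesis by blast
    next
      assume "P2 I"
      then have "\<exists>C\<in>\<D>. I \<subseteq> C" using d(4) I(1) by simp
      then show ?thesis by blast
    qed
  qed
qed

text \<open>Refining a container that violates \<open>Q\<close> costs \<open>d\<close> elements, so along any branch of refinements at
most \<open>j\<close> of them happen before \<open>Q\<close> holds, and each multiplies the number of containers by \<open>b\<close>.\<close>

lemma has_containers_iterate:
  fixes d b :: real
  assumes "1 \<le> b" "0 < d" "finite V"
    and refine: "\<And>C. C \<subseteq> V \<Longrightarrow> \<not> Q C \<Longrightarrow>
      has_containers C P (\<lambda>C'. real (card C') + d \<le> real (card C)) b"
  shows "C \<subseteq> V \<Longrightarrow> real (card C) \<le> real j * d \<Longrightarrow> has_containers C P Q (b ^ j)"
proof (induction j arbitrary: C)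
  case 0
  show ?case
  proof (cases "Q C")
    case True
    then show ?thesis by (intro has_containersI[of "{C}"]) auto
  next
    case False
    obtain \<C> where c: "\<forall>C'\<in>\<C>. real (card C') + d \<le> real (card C)"
      "\<forall>I. I \<subseteq> C \<and> P I \<longrightarrow> (\<exists>C\<in>\<C>. I \<subseteq> C)"
      using refine[OF 0(1) False] unfolding has_containers_def by blast
    \<comment> \<open>There is no room left for a refinement, so no set satisfying P lies inside C.\<close>
    have "\<C> = {}"
    proof (rule ccontr)
      assume "\<C> \<noteq> {}"
      then obtain C' where "C' \<in> \<C>" by blast
      then have "real (card C') + d \<le> real (card C)" using c(1) by blast
      then show False using 0(2) assms(2) by simp
    qed
    with c(2) show ?thesis by (intro has_containersI[of "{}"]) auto
  qed
next
  case (Suc j)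
  show ?case
  proof (cases "Q C")
    case True
    then show ?thesis using assms(1) one_le_power[of b "Suc j"]
      by (intro has_containersI[of "{C}"]) auto
  next
    case False
    obtain \<C> where c': "finite \<C>" "real (card \<C>) \<le> b"
      "\<forall>C'\<in>\<C>. C' \<subseteq> C \<and> real (card C') + d \<le> real (card C)"
      "\<forall>I. I \<subseteq> C \<and> P I \<longrightarrow> (\<exists>C\<in>\<C>. I \<subseteq> C)"
      using refine[OF Suc(2) False] unfolding has_containers_def by blast
    then have c: "finite \<C>" "real (card \<C>) \<le> b"
      "\<And>C'. C' \<in> \<C> \<Longrightarrow> C' \<subseteq> C" "\<And>C'. C' \<in> \<C> \<Longrightarrow> real (card C') + d \<le> real (card C)"
      "\<And>I. I \<subseteq> C \<Longrightarrow> P I \<Longrightarrow> (\<exists>C\<in>\<C>. I \<subseteq> C)"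
      by blast+
    have "has_containers C P Q (real (card \<C>) * b ^ j)"
    proof (rule has_containers_Union[OF c(1), where P = "\<lambda>C' I. I \<subseteq> C' \<and> P I"])
      fix C' assume C': "C' \<in> \<C>"
      have "real (card C') \<le> real j * d"
        using c(4)[OF C'] Suc(3) by (simp add: algebra_simps)
      then have "has_containers C' P Q (b ^ j)" using Suc.IH c(3)[OF C'] Suc(2) by blast
      then show "has_containers C (\<lambda>I. I \<subseteq> C' \<and> P I) Q (b ^ j)"
        by (rule has_containers_mono) (use c(3)[OF C'] in auto)
    next
      show "\<exists>C'\<in>\<C>. I \<subseteq> C' \<and> P I" if "I \<subseteq> C" "P I" for I
        using c(5)[OF that] that(2) by blast
    qed
    then show ?thesis
      by (rule has_containers_mono) (use c(2) assms(1) in \<open>auto intro: mult_right_mono\<close>)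
  qed
qed

text \<open>Double counting of incidences.\<close>

lemma sum_card_star:
  assumes "finite V" "finite E" "\<And>e. e \<in> E \<Longrightarrow> \<phi> e \<subseteq> V"
  shows "(\<Sum>u\<in>V. card (star E \<phi> u)) = (\<Sum>e\<in>E. card (\<phi> e))"
proof -
  have "(\<Sum>u\<in>V. card (star E \<phi> u)) = (\<Sum>u\<in>V. \<Sum>e\<in>E. if u \<in> \<phi> e then 1 else 0)"
    using assms(2) by (intro sum.cong) (auto simp: star_def sum.If_cases Int_def)
  also have "\<dots> = (\<Sum>e\<in>E. \<Sum>u\<in>V. if u \<in> \<phi> e then 1 else 0)" by (rule sum.swap)
  also have "\<dots> = (\<Sum>e\<in>E. card (\<phi> e))"
  proof (intro sum.cong refl)
    fix e assume "e \<in> E"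
    then have "V \<inter> {u. u \<in> \<phi> e} = \<phi> e" using assms(3) by auto
    then show "(\<Sum>u\<in>V. if u \<in> \<phi> e then 1 else 0) = card (\<phi> e)"
      using assms(1) by (simp add: sum.If_cases)
  qed
  finally show ?thesis .
qed

lemma many_high_degree_vertices:
  fixes \<alpha> D N :: real
  assumes "finite V" "real (card V) \<le> N" "finite E" "\<And>e. e \<in> E \<Longrightarrow> \<phi> e \<subseteq> V \<and> \<phi> e \<noteq> {}"
    and "\<And>u. u \<in> V \<Longrightarrow> real (card (star E \<phi> u)) \<le> D"
    and "2 * \<alpha> * N * D \<le> real (card E)" "0 < D" "0 \<le> \<alpha>"
  shows "\<alpha> * N \<le> real (card {u \<in> V. \<alpha> * D \<le> real (card (star E \<phi> u))})"
proof -
  let ?H = "{u \<in> V. \<alpha> * D \<le> real (card (star E \<phi> u))}"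
  have "card E = (\<Sum>e\<in>E. 1)" by simp
  also have "\<dots> \<le> (\<Sum>e\<in>E. card (\<phi> e))"
  proof (rule sum_mono)
    fix e assume "e \<in> E"
    then have "finite (\<phi> e)" "\<phi> e \<noteq> {}" using assms finite_subset by blast+
    then show "1 \<le> card (\<phi> e)" by (simp add: Suc_le_eq card_gt_0_iff)
  qed
  also have "\<dots> = (\<Sum>u\<in>V. card (star E \<phi> u))" using assms by (intro sum_card_star[symmetric]) auto
  finally have "real (card E) \<le> (\<Sum>u\<in>V. real (card (star E \<phi> u)))"
    by (metis of_nat_mono of_nat_sum)
  also have "\<dots> = (\<Sum>u\<in>?H. real (card (star E \<phi> u))) + (\<Sum>u\<in>V - ?H. real (card (star E \<phi> u)))"
    using assms(1) by (subst sum.subset_diff[of ?H V]) auto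
  also have "\<dots> \<le> real (card ?H) * D + real (card (V - ?H)) * (\<alpha> * D)"
  proof (intro add_mono sum_bounded_above)
    show "real (card (star E \<phi> u)) \<le> D" if "u \<in> ?H" for u using assms(5) that by simp
    show "real (card (star E \<phi> u)) \<le> \<alpha> * D" if "u \<in> V - ?H" for u using that by auto
  qed
  also have "\<dots> \<le> real (card ?H) * D + N * (\<alpha> * D)"
  proof -
    have "card (V - ?H) \<le> card V" by (rule card_mono) (use assms(1) in auto)
    then have "real (card (V - ?H)) \<le> N" using assms(2) by linarith
    then show ?thesis using assms(7,8) by (simp add: mult_right_mono)
  qed
  finally have "2 * \<alpha> * N * D \<le> real (card ?H) * D + N * (\<alpha> * D)" using assms(6) by linarith
  then have "(\<alpha> * N) * D \<le> real (card ?H) * D" by (simp add: algebra_simps)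
  then show ?thesis using assms(7) by simp
qed

section \<open>Collecting links\<close>

text \<open>The edges still available after the vertices \<open>S\<close> have been chosen and the links \<open>(G, \<psi>)\<close> collected.
A vertex is saturated once its degree in \<open>G\<close> exceeds \<open>t\<close>; edges through saturated vertices are given up.\<close>

definition live :: "'e set \<Rightarrow> ('e \<Rightarrow> 'v set) \<Rightarrow> real \<Rightarrow> 'v set \<Rightarrow> 'e set \<Rightarrow> ('e \<Rightarrow> 'v set) \<Rightarrow> 'e set"
  where "live E \<phi> t S G \<psi> = {e \<in> E. \<phi> e \<inter> S = {} \<and> (\<forall>u\<in>\<phi> e. real (card (star G \<psi> u)) \<le> t)}"

text \<open>The invariant after \<open>i\<close> choices. The bound on degrees is \<open>t + B\<close> rather than \<open>t\<close>, because the choice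
that saturates a vertex may overshoot by one codegree; the last conjunct records
the \<open>a\<close> or more edges that each choice contributes.\<close>

definition partial_link :: "'v set \<Rightarrow> 'e set \<Rightarrow> ('e \<Rightarrow> 'v set) \<Rightarrow> nat \<Rightarrow> real \<Rightarrow> real \<Rightarrow> real \<Rightarrow>
    nat \<Rightarrow> 'v set \<Rightarrow> 'e set \<Rightarrow> ('e \<Rightarrow> 'v set) \<Rightarrow> bool" where
  "partial_link V E \<phi> s t B a i S G \<psi> \<longleftrightarrow>
     S \<subseteq> V \<and> card S \<le> i \<and> G \<subseteq> E \<and>
     (\<forall>e\<in>G. \<phi> e \<inter> S \<noteq> {} \<and> \<psi> e \<subseteq> \<phi> e \<and> card (\<psi> e) = s) \<and>
     (\<forall>u\<in>V. real (card (star G \<psi> u)) \<le> t + B) \<and> real i * a \<le> real (card G)"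

lemma star_mono: "E \<subseteq> E' \<Longrightarrow> star E \<phi> u \<subseteq> star E' \<phi> u"
  by (auto simp: star_def)

text \<open>Live edges avoid \<open>S\<close>, so the link of the new vertex brings only edges that are not yet in \<open>G\<close>. The
degree of \<open>u\<close> can change only if \<open>u\<close> lies in a live edge, hence is not saturated, and then it grows by
at most the codegree of \<open>u\<close> and the new vertex.\<close>

lemma partial_link_extend:
  fixes t B a :: real
  assumes H: "hypergraph V E \<phi> (Suc s) D B" and "0 \<le> B"
    and P: "partial_link V E \<phi> s t B a i S G \<psi>"
    and v: "v \<in> V" "a \<le> real (card (star (live E \<phi> t S G \<psi>) \<phi> v))"
  defines "X \<equiv> star (live E \<phi> t S G \<psi>) \<phi> v"
  shows "partial_link V E \<phi> s t B a (Suc i) (insert v S) (G \<union> X)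
    (\<lambda>e. if e \<in> G then \<psi> e else \<phi> e - {v})"
proof -
  let ?\<psi> = "\<lambda>e. if e \<in> G then \<psi> e else \<phi> e - {v}"
  have fin: "finite V" "finite E" and un: "\<And>e. e \<in> E \<Longrightarrow> \<phi> e \<subseteq> V \<and> card (\<phi> e) = Suc s"
    and codeg: "\<And>u w. u \<in> V \<Longrightarrow> w \<in> V \<Longrightarrow> u \<noteq> w \<Longrightarrow>
      real (card (star E \<phi> u \<inter> star E \<phi> w)) \<le> B"
    using H unfolding hypergraph_def by auto
  have S: "S \<subseteq> V" "card S \<le> i" and G: "G \<subseteq> E"
    and GS: "\<And>e. e \<in> G \<Longrightarrow> \<phi> e \<inter> S \<noteq> {} \<and> \<psi> e \<subseteq> \<phi> e \<and> card (\<psi> e) = s"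
    and Gdeg: "\<And>u. u \<in> V \<Longrightarrow> real (card (star G \<psi> u)) \<le> t + B"
    and Gsize: "real i * a \<le> real (card G)"
    using P unfolding partial_link_def by auto
  have XE: "X \<subseteq> E" and Xv: "\<And>e. e \<in> X \<Longrightarrow> v \<in> \<phi> e"
    and Xlow: "\<And>e u. e \<in> X \<Longrightarrow> u \<in> \<phi> e \<Longrightarrow> real (card (star G \<psi> u)) \<le> t"
    and XS: "\<And>e. e \<in> X \<Longrightarrow> \<phi> e \<inter> S = {}"
    unfolding X_def star_def live_def by auto
  have disj: "G \<inter> X = {}" using GS XS by blast
  have finG: "finite G" "finite X" using G XE fin(2) finite_subset by auto
  have "card (insert v S) \<le> Suc i" 
    using S finite_subset[OF S(1) fin(1)] by (simp add: card_insert_if)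
  moreover have "\<phi> e \<inter> insert v S \<noteq> {} \<and> ?\<psi> e \<subseteq> \<phi> e \<and> card (?\<psi> e) = s" if "e \<in> G \<union> X" for e
  proof (cases "e \<in> G")
    case True
    then show ?thesis using GS by auto
  next
    case False
    then have e: "e \<in> X" using that by simp
    have "finite (\<phi> e)" using un XE e fin(1) finite_subset by blast
    then show ?thesis using False e Xv un XE by auto
  qed
  moreover have "real (card (star (G \<union> X) ?\<psi> u)) \<le> t + B" if u: "u \<in> V" for u
  proof (cases "\<exists>e\<in>X. u \<in> \<phi> e \<and> u \<noteq> v")
    case True
    then have low: "real (card (star G \<psi> u)) \<le> t" and "u \<noteq> v" using Xlow by auto
    have "star (G \<union> X) ?\<psi> u \<subseteq> star G \<psi> u \<union> (star E \<phi> u \<inter> star E \<phi> v)"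
      using Xv XE by (auto simp: star_def)
    then have "card (star (G \<union> X) ?\<psi> u) \<le> card (star G \<psi> u \<union> (star E \<phi> u \<inter> star E \<phi> v))"
      using finG(1) fin(2) by (intro card_mono) (auto simp: star_def)
    also have "\<dots> \<le> card (star G \<psi> u) + card (star E \<phi> u \<inter> star E \<phi> v)" by (rule card_Un_le)
    finally show ?thesis using low codeg[OF u v(1) \<open>u \<noteq> v\<close>] by linarith
  next
    case False
    then have "star (G \<union> X) ?\<psi> u = star G \<psi> u" using Xv by (auto simp: star_def)
    then show ?thesis using Gdeg[OF u] by simp
  qed
  moreover have "real (Suc i) * a \<le> real (card (G \<union> X))"
    using v(2) Gsize disj finG by (simp add: card_Un_disjoint algebra_simps X_def)
  ultimately show ?thesis
    using S(1) v(1) G XE unfolding partial_link_def by simp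
qed

text \<open>A link edge \<open>\<phi> e - {v}\<close> inside \<open>I\<close> would, together with \<open>v \<in> I\<close>, put the whole edge \<open>\<phi> e\<close> inside \<open>I\<close>.\<close>

lemma edge_free_extend_link:
  assumes "edge_free E \<phi> I" "edge_free G \<psi> I" "v \<in> I" "X \<subseteq> star E \<phi> v"
  shows "edge_free (G \<union> X) (\<lambda>e. if e \<in> G then \<psi> e else \<phi> e - {v}) I"
  unfolding edge_free_def
proof
  fix e assume e: "e \<in> G \<union> X"
  show "\<not> (if e \<in> G then \<psi> e else \<phi> e - {v}) \<subseteq> I"
  proof (cases "e \<in> G")
    case True
    then show ?thesis using assms(2) by (simp add: edge_free_def)
  next
    case False
    then have "e \<in> E" using e assms(4) by (auto simp: star_def)
    then have "\<not> \<phi> e \<subseteq> I" using assms(1) by (simp add: edge_free_def)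
    then show ?thesis using assms(3) False by auto
  qed
qed

text \<open>The codegree bound is inherited from \<open>E\<close> unchanged, because each edge is shrunk at most once.\<close>

lemma hypergraph_of_partial_link:
  assumes H: "hypergraph V E \<phi> (Suc s) D B" and P: "partial_link V E \<phi> s t B a i S G \<psi>"
    and "t + B \<le> D'"
  shows "hypergraph V G \<psi> s D' B"
proof -
  have G: "G \<subseteq> E" and fin: "finite E" "finite V" using H P unfolding hypergraph_def partial_link_def by auto
  have sub: "\<psi> e \<subseteq> \<phi> e" if "e \<in> G" for e using P that unfolding partial_link_def by auto
  have "real (card (star G \<psi> u \<inter> star G \<psi> w)) \<le> B" if "u \<in> V" "w \<in> V" "u \<noteq> w" for u w
  proof -
    have "card (star G \<psi> u \<inter> star G \<psi> w) \<le> card (star E \<phi> u \<inter> star E \<phi> w)"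
      using sub G fin by (intro card_mono) (auto simp: star_def)
    moreover have "real (card (star E \<phi> u \<inter> star E \<phi> w)) \<le> B"
      using H that by (simp add: hypergraph_def)
    ultimately show ?thesis by linarith
  qed
  moreover have "real (card (star G \<psi> u)) \<le> D'" if "u \<in> V" for u
  proof -
    have "real (card (star G \<psi> u)) \<le> t + B" using P that by (simp add: partial_link_def)
    then show ?thesis using assms(3) by linarith
  qed
  moreover have "\<psi> e \<subseteq> V \<and> card (\<psi> e) = s" if "e \<in> G" for e
  proof -
    have "\<phi> e \<subseteq> V" using H G that by (auto simp: hypergraph_def)
    then have "\<psi> e \<subseteq> V" using sub[OF that] by simp
    then show ?thesis using P that by (simp add: partial_link_def)
  qed
  ultimately show ?thesis using fin finite_subset[OF G] unfolding hypergraph_def by simp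
qed

text \<open>An edge dies because it meets \<open>S\<close> or contains a saturated vertex. The first accounts for at most
\<open>q * D\<close> edges. For the second, \<open>G\<close> itself consists of edges meeting \<open>S\<close> and so has at most \<open>q * D\<close>
elements; since each saturated vertex uses up degree \<open>t\<close> in it, the choice of \<open>t\<close> leaves at most
\<open>\<epsilon> / 4 * N\<close> saturated vertices.\<close>

lemma live_edges_many:
  fixes N D \<epsilon> :: real
  assumes H: "hypergraph V E \<phi> (Suc s) D B"
    and P: "partial_link V E \<phi> s t B a i S G \<psi>"
    and pos: "0 < s" "0 < D" "0 < N" "0 < q" "0 < \<epsilon>"
    and i: "i \<le> q" and q: "real q \<le> \<epsilon> / 4 * N"
    and E: "\<epsilon> * N * D \<le> real (card E)"
    and t: "t = 4 * real s / \<epsilon> * (real q / N) * D"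
  shows "\<epsilon> / 2 * N * D \<le> real (card (live E \<phi> t S G \<psi>))"
proof -
  define Sat where "Sat = {u \<in> V. t < real (card (star G \<psi> u))}"
  have fin: "finite V" "finite E" and un: "\<And>e. e \<in> E \<Longrightarrow> \<phi> e \<subseteq> V"
    and deg: "\<And>u. u \<in> V \<Longrightarrow> real (card (star E \<phi> u)) \<le> D"
    using H unfolding hypergraph_def by auto
  have S: "S \<subseteq> V" "card S \<le> i" and G: "G \<subseteq> E"
    and GS: "\<And>e. e \<in> G \<Longrightarrow> \<phi> e \<inter> S \<noteq> {} \<and> \<psi> e \<subseteq> \<phi> e \<and> card (\<psi> e) = s"
    using P unfolding partial_link_def by auto
  have finG: "finite G" "finite S" "finite Sat" using finite_subset fin S G by (auto simp: Sat_def)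
  have touch: "real (card (\<Union>u\<in>A. star E \<phi> u)) \<le> real (card A) * D" if "A \<subseteq> V" for A
  proof -
    have "finite A" using that fin(1) finite_subset by blast
    then have "real (card (\<Union>u\<in>A. star E \<phi> u)) \<le> (\<Sum>u\<in>A. real (card (star E \<phi> u)))"
      using card_UN_le[of A "star E \<phi>"] by (metis of_nat_mono of_nat_sum)
    also have "\<dots> \<le> real (card A) * D"
      using deg that by (intro sum_bounded_above) auto
    finally show ?thesis .
  qed
  have SD: "real (card S) * D \<le> real q * D" using S(2) i pos(2) by simp
  have "G \<subseteq> (\<Union>u\<in>S. star E \<phi> u)" using GS G by (fastforce simp: star_def)
  then have "card G \<le> card (\<Union>u\<in>S. star E \<phi> u)"
    using finG(2) fin(2) by (intro card_mono) (auto simp: star_def)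
  then have Gle: "real (card G) \<le> real q * D" using touch[OF S(1)] SD by linarith
  have tpos: "0 < t" unfolding t using pos by simp
  have "real (card Sat) * t \<le> (\<Sum>u\<in>Sat. real (card (star G \<psi> u)))"
    by (intro sum_bounded_below) (auto simp: Sat_def)
  also have "\<dots> \<le> (\<Sum>u\<in>V. real (card (star G \<psi> u)))"
    using fin(1) by (intro sum_mono2) (auto simp: Sat_def)
  also have "\<dots> = real (\<Sum>e\<in>G. card (\<psi> e))"
  proof -
    have "\<And>e. e \<in> G \<Longrightarrow> \<psi> e \<subseteq> V" using GS un G by blast
    then show ?thesis using sum_card_star[OF fin(1) finG(1), of \<psi>] by (metis of_nat_sum)
  qed
  also have "\<dots> = real s * real (card G)" using GS by simp
  also have "\<dots> \<le> real s * (real q * D)" using Gle by (intro mult_left_mono) auto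
  finally have "real (card Sat) * t \<le> real s * (real q * D)" .
  also have "\<dots> = (\<epsilon> / 4 * N) * t" unfolding t using pos by (simp add: field_simps)
  finally have "real (card Sat) \<le> \<epsilon> / 4 * N" using tpos by simp
  then have SatD: "real (card Sat) * D \<le> \<epsilon> / 4 * N * D" using pos(2) by (intro mult_right_mono) auto
  have "E \<subseteq> live E \<phi> t S G \<psi> \<union> ((\<Union>u\<in>S. star E \<phi> u) \<union> (\<Union>u\<in>Sat. star E \<phi> u))"
    using un by (fastforce simp: live_def star_def Sat_def not_le)
  then have "card E \<le> card (live E \<phi> t S G \<psi> \<union> ((\<Union>u\<in>S. star E \<phi> u) \<union> (\<Union>u\<in>Sat. star E \<phi> u)))"
    using finG fin by (intro card_mono) (auto simp: star_def live_def)
  also have "\<dots> \<le> card (live E \<phi> t S G \<psi>) + (card (\<Union>u\<in>S. star E \<phi> u) + card (\<Union>u\<in>Sat. star E \<phi> u))"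
    using card_Un_le by (metis (no_types, lifting) add_left_mono order_trans)
  finally have "real (card E) \<le> real (card (live E \<phi> t S G \<psi>)) +
    (real (card (\<Union>u\<in>S. star E \<phi> u)) + real (card (\<Union>u\<in>Sat. star E \<phi> u)))" by linarith
  moreover have "real (card (\<Union>u\<in>Sat. star E \<phi> u)) \<le> \<epsilon> / 4 * N * D"
    using touch[of Sat] SatD by (force simp: Sat_def)
  moreover have "real (card (\<Union>u\<in>S. star E \<phi> u)) \<le> \<epsilon> / 4 * N * D"
    using touch[OF S(1)] SD mult_right_mono[OF q, of D] pos(2) by linarith
  ultimately show ?thesis using E by linarith
qed

text \<open>Reduces uniformity \<open>s + 1\<close> to uniformity \<open>s\<close>. Ranging over all possible choices gives a tree of
depth \<open>q\<close> in which every node has at most \<open>N\<close> children and contributes one more container, the set of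
vertices of small degree in the live hypergraph.\<close>

lemma container_step:
  fixes N D \<epsilon> b :: real and E :: "'e set"
  assumes H: "hypergraph V E \<phi> (Suc s) D B" and B0: "0 \<le> B"
    and pos: "0 < s" "0 < D" "0 < N" "0 < q" "0 < \<epsilon>"
    and VN: "real (card V) \<le> N" and q: "real q \<le> \<epsilon> / 4 * N"
    and E: "\<epsilon> * N * D \<le> real (card E)" and B: "B \<le> D * (real q / N)"
    and Q: "\<And>C. C \<subseteq> V \<Longrightarrow> real (card C) + \<epsilon> / 4 * N \<le> real (card V) \<Longrightarrow> Q C"
    and link: "\<And>(G :: 'e set) \<psi>. hypergraph V G \<psi> s ((4 * real s / \<epsilon> + 1) * (real q / N) * D) B \<Longrightarrow>
      \<epsilon> / 4 * real q * D \<le> real (card G) \<Longrightarrow> has_containers V (edge_free G \<psi>) Q b"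
    and b: "1 \<le> b"
  shows "has_containers V (edge_free E \<phi>) Q ((N + 1) ^ q * b)"
proof -
  define t where "t = 4 * real s / \<epsilon> * (real q / N) * D"
  define a where "a = \<epsilon> / 4 * D"
  have fin: "finite V" "finite E" and un: "\<And>e. e \<in> E \<Longrightarrow> \<phi> e \<subseteq> V \<and> card (\<phi> e) = Suc s"
    and deg: "\<And>u. u \<in> V \<Longrightarrow> real (card (star E \<phi> u)) \<le> D"
    using H unfolding hypergraph_def by auto
  \<comment> \<open>Induction on the number j of choices that remain.\<close>
  have main: "j \<le> q \<Longrightarrow> partial_link V E \<phi> s t B a (q - j) S G \<psi> \<Longrightarrow>
      has_containers V (\<lambda>I. edge_free E \<phi> I \<and> edge_free G \<psi> I) Q ((N + 1) ^ j * b)"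
    for j S \<psi> and G :: "'e set"
  proof (induction j arbitrary: S \<psi> G)
    case 0
    have "hypergraph V G \<psi> s ((4 * real s / \<epsilon> + 1) * (real q / N) * D) B"
      by (rule hypergraph_of_partial_link[OF H 0(2)]) (use B in \<open>simp add: t_def algebra_simps\<close>)
    moreover have "\<epsilon> / 4 * real q * D \<le> real (card G)"
      using 0(2) unfolding partial_link_def a_def by (simp add: algebra_simps)
    ultimately have "has_containers V (edge_free G \<psi>) Q b" by (rule link)
    then show ?case by (rule has_containers_mono) auto
  next
    case (Suc j)
    define R where "R = live E \<phi> t S G \<psi>"
    define High where "High = {u \<in> V. a \<le> real (card (star R \<phi> u))}"
    have RE: "R \<subseteq> E" by (auto simp: R_def live_def)
    have "\<epsilon> / 2 * N * D \<le> real (card R)" unfolding R_def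
      by (rule live_edges_many[OF H Suc(3) pos _ q E t_def]) simp
    then have "\<epsilon> / 4 * N \<le> real (card High)" unfolding High_def a_def
    proof (intro many_high_degree_vertices)
      show "\<phi> e \<subseteq> V \<and> \<phi> e \<noteq> {}" if "e \<in> R" for e using un[of e] RE that by auto
      show "real (card (star R \<phi> u)) \<le> D" if "u \<in> V" for u
      proof -
        have "card (star R \<phi> u) \<le> card (star E \<phi> u)"
          using star_mono[OF RE] fin(2) by (intro card_mono) (simp_all add: star_def)
        then show ?thesis using deg[OF that] by linarith
      qed
    qed (use fin VN pos finite_subset[OF RE] in auto)
    moreover have "real (card (V - High)) = real (card V) - real (card High)"
      using fin(1) by (subst card_Diff_subset) (auto simp: High_def of_nat_diff card_mono)
    ultimately have low: "Q (V - High)" by (intro Q) auto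
    have "has_containers V (\<lambda>I. I \<subseteq> V - High) Q 1"
      by (rule has_containersI[of "{V - High}"]) (use low in auto)
    moreover have "has_containers V (\<lambda>I. (edge_free E \<phi> I \<and> edge_free G \<psi> I) \<and> \<not> I \<subseteq> V - High) Q
        (real (card High) * ((N + 1) ^ j * b))"
    proof (rule has_containers_Union[where
          P = "\<lambda>v I. v \<in> I \<and> edge_free E \<phi> I \<and> edge_free G \<psi> I"])
      show "finite High" using fin(1) by (simp add: High_def)
      show "has_containers V (\<lambda>I. v \<in> I \<and> edge_free E \<phi> I \<and> edge_free G \<psi> I) Q ((N + 1) ^ j * b)"
        if v: "v \<in> High" for v
      proof -
        have v': "v \<in> V" "a \<le> real (card (star (live E \<phi> t S G \<psi>) \<phi> v))"
          using v unfolding High_def R_def by auto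
        have "partial_link V E \<phi> s t B a (q - j) (insert v S) (G \<union> star R \<phi> v)
            (\<lambda>e. if e \<in> G then \<psi> e else \<phi> e - {v})"
          using partial_link_extend[OF H B0 Suc(3) v'] Suc(2) unfolding R_def
          by (simp add: Suc_diff_Suc Suc_le_eq)
        from Suc.IH[OF _ this] Suc(2)
        have "has_containers V (\<lambda>I. edge_free E \<phi> I \<and> edge_free (G \<union> star R \<phi> v)
            (\<lambda>e. if e \<in> G then \<psi> e else \<phi> e - {v}) I) Q ((N + 1) ^ j * b)" by simp
        then show ?thesis
          by (rule has_containers_mono) (simp_all add: edge_free_extend_link[OF _ _ _ star_mono[OF RE]])
      qed
      show "\<exists>v\<in>High. v \<in> I \<and> edge_free E \<phi> I \<and> edge_free G \<psi> I"
        if "I \<subseteq> V" "(edge_free E \<phi> I \<and> edge_free G \<psi> I) \<and> \<not> I \<subseteq> V - High" for I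
        using that by auto
    qed
    ultimately have "has_containers V (\<lambda>I. edge_free E \<phi> I \<and> edge_free G \<psi> I) Q
        (1 + real (card High) * ((N + 1) ^ j * b))"
      by (rule has_containers_disj) simp
    then show ?case
    proof (rule has_containers_mono)
      have "card High \<le> card V" using fin(1) by (intro card_mono) (auto simp: High_def)
      then have "real (card High) \<le> N" using VN by linarith
      moreover have "1 \<le> (N + 1) ^ j * b"
        using mult_mono[of 1 "(N + 1) ^ j" 1 b] b pos(3) one_le_power[of "N + 1" j] by simp
      ultimately have "1 + real (card High) * ((N + 1) ^ j * b) \<le> (N + 1) ^ j * b + N * ((N + 1) ^ j * b)"
        using mult_right_mono[of "real (card High)" N "(N + 1) ^ j * b"] by linarith
      then show "1 + real (card High) * ((N + 1) ^ j * b) \<le> (N + 1) ^ Suc j * b"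
        by (simp add: algebra_simps)
    qed auto
  qed
  have "has_containers V (\<lambda>I. edge_free E \<phi> I \<and> edge_free ({} :: 'e set) (\<lambda>_. {}) I) Q ((N + 1) ^ q * b)"
  proof -
    have "0 \<le> t + B" unfolding t_def using pos B0 by simp
    then have "partial_link V E \<phi> s t B a (q - q) {} {} (\<lambda>_. {})"
      unfolding partial_link_def by (simp add: star_def)
    then show ?thesis by (rule main[OF order_refl])
  qed
  then show ?thesis by (rule has_containers_mono) (auto simp: edge_free_def)
qed

section \<open>A container theorem for degrees and codegrees\<close>

text \<open>In the base case, an independent set in a \<open>1\<close>-uniform hypergraph avoids all edges, and by the degree
bound these occupy at least \<open>\<epsilon> * N\<close> vertices. In the step, passing to links multiplies the scale of
the degrees by about \<open>q / N\<close> and leaves \<open>B\<close> alone, so starting from \<open>B \<le> D * (q / N) ^ s\<close> there is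
room for all \<open>s\<close> reductions with the same \<open>q\<close>.\<close>

lemma containers_one_round:
  fixes \<epsilon> :: real
  assumes "1 \<le> s" "0 < \<epsilon>"
  shows "\<exists>\<delta>>0. \<delta> \<le> 1 \<and> (\<forall>(V :: 'v set) (E :: 'e set) \<phi> D B N q.
    hypergraph V E \<phi> s D B \<and> 0 < D \<and> 0 \<le> B \<and> 0 < N \<and> real (card V) \<le> N \<and> 0 < q \<and>
    real q \<le> \<delta> * N \<and> B \<le> D * (real q / N) ^ s \<and> \<epsilon> * N * D \<le> real (card E) \<longrightarrow>
    has_containers V (edge_free E \<phi>) (\<lambda>C. real (card C) + \<delta> * N \<le> real (card V))
      ((N + 1) ^ (s * q)))"
  using assms
proof (induction s arbitrary: \<epsilon> rule: nat_induct_at_least)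
  case base
  have "has_containers V (edge_free E \<phi>) (\<lambda>C. real (card C) + min \<epsilon> 1 * N \<le> real (card V))
      ((N + 1) ^ (1 * q))"
    if H: "hypergraph V E \<phi> 1 D B" and pos: "0 < D" "0 < N" and E: "\<epsilon> * N * D \<le> real (card E)"
    for V :: "'v set" and E :: "'e set" and \<phi> D B N q
  proof -
    define F where "F = (\<Union>e\<in>E. \<phi> e)"
    have fin: "finite V" "finite E" and un: "\<And>e. e \<in> E \<Longrightarrow> \<phi> e \<subseteq> V \<and> card (\<phi> e) = 1"
      and deg: "\<And>u. u \<in> V \<Longrightarrow> real (card (star E \<phi> u)) \<le> D"
      using H unfolding hypergraph_def by auto
    have F: "F \<subseteq> V" using un by (auto simp: F_def)
    then have finF: "finite F" using fin(1) finite_subset by blast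
    have "E \<subseteq> (\<Union>u\<in>F. star E \<phi> u)"
    proof
      fix e assume e: "e \<in> E"
      then obtain u where "\<phi> e = {u}" using un by (meson card_1_singletonE)
      then show "e \<in> (\<Union>u\<in>F. star E \<phi> u)" using e by (auto simp: star_def F_def)
    qed
    then have "card E \<le> card (\<Union>u\<in>F. star E \<phi> u)"
      using finF fin by (intro card_mono) (auto simp: star_def)
    also have "\<dots> \<le> (\<Sum>u\<in>F. card (star E \<phi> u))" by (rule card_UN_le[OF finF])
    finally have "real (card E) \<le> (\<Sum>u\<in>F. real (card (star E \<phi> u)))"
      by (metis of_nat_mono of_nat_sum)
    also have "\<dots> \<le> real (card F) * D" using deg F by (intro sum_bounded_above) auto
    finally have "\<epsilon> * N * D \<le> real (card F) * D" using E by linarith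
    then have "\<epsilon> * N \<le> real (card F)" using pos(1) by simp
    moreover have "min \<epsilon> 1 * N \<le> \<epsilon> * N" using pos(2) by (intro mult_right_mono) auto
    moreover have "real (card (V - F)) = real (card V) - real (card F)"
      using F finF fin(1) by (simp add: card_Diff_subset of_nat_diff card_mono)
    ultimately have small: "real (card (V - F)) + min \<epsilon> 1 * N \<le> real (card V)" by linarith
    have avoid: "I \<subseteq> V - F" if "I \<subseteq> V" "edge_free E \<phi> I" for I
    proof
      fix u assume u: "u \<in> I"
      have "u \<notin> F"
      proof
        assume "u \<in> F"
        then obtain e where e: "e \<in> E" "u \<in> \<phi> e" by (auto simp: F_def)
        then have "\<phi> e = {u}" using un by (metis card_1_singletonE singletonD)
        then show False using that(2) u e unfolding edge_free_def by auto
      qed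
      then show "u \<in> V - F" using u that(1) by auto
    qed
    have "1 \<le> (N + 1) ^ (1 * q)" using pos(2) by (intro one_le_power) simp
    then show ?thesis
      by (intro has_containersI[of "{V - F}"]) (simp_all add: small avoid)
  qed
  then show ?case using base by (intro exI[of _ "min \<epsilon> 1"]) auto
next
  case (Suc s)
  define K where "K = 4 * real s / \<epsilon> + 1"
  have K: "1 \<le> K" using Suc.prems by (simp add: K_def)
  have "0 < \<epsilon> / 4 / K" using K Suc.prems by simp
  from Suc.IH[OF this] obtain \<delta>' where \<delta>': "0 < \<delta>'" "\<delta>' \<le> 1"
    and IH: "\<And>(V :: 'v set) (E :: 'e set) \<phi> D B N q.
    hypergraph V E \<phi> s D B \<Longrightarrow> 0 < D \<Longrightarrow> 0 \<le> B \<Longrightarrow> 0 < N \<Longrightarrow> real (card V) \<le> N \<Longrightarrow> 0 < q \<Longrightarrow>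
    real q \<le> \<delta>' * N \<Longrightarrow> B \<le> D * (real q / N) ^ s \<Longrightarrow> \<epsilon> / 4 / K * N * D \<le> real (card E) \<Longrightarrow>
    has_containers V (edge_free E \<phi>) (\<lambda>C. real (card C) + \<delta>' * N \<le> real (card V))
      ((N + 1) ^ (s * q))"
    by metis
  define \<delta> where "\<delta> = min \<delta>' (\<epsilon> / 4)"
  have \<delta>: "0 < \<delta>" "\<delta> \<le> \<delta>'" "\<delta> \<le> 1" "\<delta> \<le> \<epsilon> / 4" using \<delta>' Suc.prems by (auto simp: \<delta>_def)
  have "has_containers V (edge_free E \<phi>) (\<lambda>C. real (card C) + \<delta> * N \<le> real (card V))
      ((N + 1) ^ (Suc s * q))"
    if H: "hypergraph V E \<phi> (Suc s) D B" and pos: "0 < D" "0 \<le> B" "0 < N"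
      and VN: "real (card V) \<le> N" and q: "0 < q" "real q \<le> \<delta> * N"
      and B: "B \<le> D * (real q / N) ^ Suc s" and E: "\<epsilon> * N * D \<le> real (card E)"
    for V :: "'v set" and E :: "'e set" and \<phi> D B N q
  proof -
    define x where "x = real q / N"
    have dN: "\<delta> * N \<le> \<delta>' * N" "\<delta> * N \<le> \<epsilon> / 4 * N" "\<delta> * N \<le> 1 * N"
      using \<delta> pos(3) by (auto intro!: mult_right_mono)
    have x: "0 < x" "x \<le> 1" using q pos dN(3) by (auto simp: x_def divide_le_eq)
    have "D * x ^ Suc s \<le> D * x"
      using pos(1) x power_le_one[of x s] by (simp add: mult_left_le)
    then have Bx: "B \<le> D * (real q / N)" using B by (simp add: x_def)
    have b1: "1 \<le> (N + 1) ^ (s * q)" using pos(3) by (intro one_le_power) simp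
    have "has_containers V (edge_free E \<phi>) (\<lambda>C. real (card C) + \<delta> * N \<le> real (card V))
      ((N + 1) ^ q * (N + 1) ^ (s * q))"
    proof (rule container_step[OF H pos(2) _ pos(1) pos(3) q(1) Suc.prems VN _ E Bx _ _ b1])
      show "0 < s" using Suc.hyps by simp
      show "real q \<le> \<epsilon> / 4 * N" using q(2) dN by linarith
      show "real (card C) + \<delta> * N \<le> real (card V)"
        if "C \<subseteq> V" "real (card C) + \<epsilon> / 4 * N \<le> real (card V)" for C
        using that dN(2) by linarith
      fix G :: "'e set" and \<psi>
      let ?D = "(4 * real s / \<epsilon> + 1) * (real q / N) * D"
      assume G: "hypergraph V G \<psi> s ?D B" "\<epsilon> / 4 * real q * D \<le> real (card G)"
      have D: "?D = K * (x * D)" by (simp add: K_def x_def)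
      have xD: "0 < x * D" using x pos by simp
      have "x * D \<le> K * (x * D)" using K xD by (simp add: mult_le_cancel_right1)
      then have "x * D * x ^ s \<le> ?D * x ^ s" unfolding D using x by (intro mult_right_mono) auto
      then have BD: "B \<le> ?D * (real q / N) ^ s" using B by (simp add: x_def algebra_simps)
      have "\<epsilon> / 4 / K * N * ?D = \<epsilon> / 4 * real q * D"
        unfolding D using K pos(3) by (simp add: x_def field_simps)
      then have GD: "\<epsilon> / 4 / K * N * ?D \<le> real (card G)" using G(2) by linarith
      have q': "real q \<le> \<delta>' * N" using q(2) dN(1) by linarith
      have "0 < ?D" unfolding D using K xD by simp
      then have "has_containers V (edge_free G \<psi>)
          (\<lambda>C. real (card C) + \<delta>' * N \<le> real (card V)) ((N + 1) ^ (s * q))"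
        by (rule IH[OF G(1) _ pos(2,3) VN q(1) q' BD GD])
      then show "has_containers V (edge_free G \<psi>)
          (\<lambda>C. real (card C) + \<delta> * N \<le> real (card V)) ((N + 1) ^ (s * q))"
        by (rule has_containers_mono) (use dN(1) in auto)
    qed
    then show ?thesis by (simp add: power_add)
  qed
  then show ?case using \<delta> by (intro exI[of _ \<delta>]) blast
qed

lemma containers_one_round_uniform:
  fixes \<epsilon> :: real
  assumes "0 < \<epsilon>"
  shows "\<exists>\<delta>>0. \<delta> \<le> 1 \<and> (\<forall>(V :: 'v set) (E :: 'e set) \<phi> s D B N q.
    1 \<le> s \<and> s \<le> m \<and> hypergraph V E \<phi> s D B \<and> 0 < D \<and> 0 \<le> B \<and> 0 < N \<and> real (card V) \<le> N \<and>
    0 < q \<and> real q \<le> \<delta> * N \<and> B \<le> D * (real q / N) ^ s \<and> \<epsilon> * N * D \<le> real (card E) \<longrightarrow>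
    has_containers V (edge_free E \<phi>) (\<lambda>C. real (card C) + \<delta> * N \<le> real (card V))
      ((N + 1) ^ (m * q)))"
proof -
  let ?ok = "\<lambda>s \<delta>. \<forall>(V :: 'v set) (E :: 'e set) \<phi> D B N q.
    hypergraph V E \<phi> s D B \<and> 0 < D \<and> 0 \<le> B \<and> 0 < N \<and> real (card V) \<le> N \<and> 0 < q \<and>
    real q \<le> \<delta> * N \<and> B \<le> D * (real q / N) ^ s \<and> \<epsilon> * N * D \<le> real (card E) \<longrightarrow>
    has_containers V (edge_free E \<phi>) (\<lambda>C. real (card C) + \<delta> * N \<le> real (card V))
      ((N + 1) ^ (s * q))"
  have "\<forall>s\<in>{1..m}. \<exists>\<delta>. 0 < \<delta> \<and> \<delta> \<le> 1 \<and> ?ok s \<delta>"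
    using containers_one_round[OF _ assms] by auto
  from bchoice[OF this] obtain d where d: "\<forall>s\<in>{1..m}. 0 < d s \<and> d s \<le> 1 \<and> ?ok s (d s)" ..
  define \<delta> where "\<delta> = Min (insert 1 (d ` {1..m}))"
  have \<delta>: "0 < \<delta>" "\<delta> \<le> 1" using d by (auto simp: \<delta>_def)
  have le: "\<delta> \<le> d s" if "1 \<le> s" "s \<le> m" for s
    unfolding \<delta>_def by (rule Min_le) (use that in auto)
  have "has_containers V (edge_free E \<phi>) (\<lambda>C. real (card C) + \<delta> * N \<le> real (card V))
      ((N + 1) ^ (m * q))"
    if s: "1 \<le> s" "s \<le> m" and H: "hypergraph V E \<phi> s D B" "0 < D" "0 \<le> B" and N: "0 < N"
      "real (card V) \<le> N" "0 < q" and q: "real q \<le> \<delta> * N"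
      and B: "B \<le> D * (real q / N) ^ s" "\<epsilon> * N * D \<le> real (card E)"
    for V :: "'v set" and E :: "'e set" and \<phi> s D B N q
  proof -
    have dN: "\<delta> * N \<le> d s * N" using le s N by (intro mult_right_mono) auto
    have "s \<in> {1..m}" using s by simp
    from bspec[OF d this] have "?ok s (d s)" by (elim conjE)
    then have "has_containers V (edge_free E \<phi>) (\<lambda>C. real (card C) + d s * N \<le> real (card V))
      ((N + 1) ^ (s * q))" using H N q B dN by (meson order_trans)
    then show ?thesis
    proof (rule has_containers_mono)
      show "(N + 1) ^ (s * q) \<le> (N + 1) ^ (m * q)" using s N by (intro power_increasing) auto
    qed (use dN in auto)
  qed
  then show ?thesis using \<delta> by (intro exI[of _ \<delta>]) blast
qed

text \<open>As long as some hypergraph has too many edges inside a container, apply one round to that hypergraph,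
restricted to the container. The number \<open>J\<close> of rounds depends only on \<open>\<epsilon>\<close> and \<open>m\<close>, not on the
number of hypergraphs.\<close>

lemma containers_for_hypergraphs:
  fixes \<epsilon> :: real
  assumes "0 < \<epsilon>"
  shows "\<exists>\<delta>>0. \<exists>J :: nat. \<forall>(V :: 'v set) \<J> (E :: 'j \<Rightarrow> 'e set) \<phi> s D B N q.
    finite V \<and> 0 < N \<and> real (card V) \<le> N \<and> 0 < q \<and> real q \<le> \<delta> * N \<and>
    (\<forall>j\<in>\<J>. 1 \<le> s j \<and> s j \<le> m \<and> hypergraph V (E j) (\<phi> j) (s j) (D j) (B j) \<and>
       0 < D j \<and> 0 \<le> B j \<and> B j \<le> D j * (real q / N) ^ s j) \<longrightarrow>
    has_containers V (\<lambda>I. \<forall>j\<in>\<J>. edge_free (E j) (\<phi> j) I)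
      (\<lambda>C. \<forall>j\<in>\<J>. real (card {e \<in> E j. \<phi> j e \<subseteq> C}) < \<epsilon> * N * D j) ((N + 1) ^ (m * q * J))"
proof -
  obtain \<delta> where \<delta>: "0 < \<delta>" and round: "\<And>(V :: 'v set) (E :: 'e set) \<phi> s D B N q.
    1 \<le> s \<Longrightarrow> s \<le> m \<Longrightarrow> hypergraph V E \<phi> s D B \<Longrightarrow> 0 < D \<Longrightarrow> 0 \<le> B \<Longrightarrow> 0 < N \<Longrightarrow>
    real (card V) \<le> N \<Longrightarrow> 0 < q \<Longrightarrow> real q \<le> \<delta> * N \<Longrightarrow> B \<le> D * (real q / N) ^ s \<Longrightarrow>
    \<epsilon> * N * D \<le> real (card E) \<Longrightarrow>
    has_containers V (edge_free E \<phi>) (\<lambda>C. real (card C) + \<delta> * N \<le> real (card V))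
      ((N + 1) ^ (m * q))"
    using containers_one_round_uniform[OF assms, of m] by metis
  define J where "J = nat \<lceil>1 / \<delta>\<rceil>"
  have J: "1 \<le> real J * \<delta>"
  proof -
    have "1 / \<delta> \<le> real J" unfolding J_def by (rule real_nat_ceiling_ge)
    then show ?thesis using \<delta> by (simp add: divide_le_eq)
  qed
  have "has_containers V (\<lambda>I. \<forall>j\<in>\<J>. edge_free (E j) (\<phi> j) I)
      (\<lambda>C. \<forall>j\<in>\<J>. real (card {e \<in> E j. \<phi> j e \<subseteq> C}) < \<epsilon> * N * D j) ((N + 1) ^ (m * q * J))"
    if V: "finite V" and N: "0 < N" "real (card V) \<le> N" and q: "0 < q" "real q \<le> \<delta> * N" and
    H: "\<And>j. j \<in> \<J> \<Longrightarrow> 1 \<le> s j \<and> s j \<le> m \<and> hypergraph V (E j) (\<phi> j) (s j) (D j) (B j) \<and>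
       0 < D j \<and> 0 \<le> B j \<and> B j \<le> D j * (real q / N) ^ s j"
    for V :: "'v set" and \<J> and E :: "'j \<Rightarrow> 'e set" and \<phi> s D B N q
    unfolding power_mult[of _ "m * q"]
  proof (rule has_containers_iterate)
    show "1 \<le> (N + 1) ^ (m * q)" using N(1) by (intro one_le_power) simp
    show "0 < \<delta> * N" using \<delta> N by simp
    show "finite V" "V \<subseteq> V" using V by auto
    have "N \<le> (real J * \<delta>) * N" using J N(1) by simp
    then show "real (card V) \<le> real J * (\<delta> * N)" using N(2) by (simp add: mult.assoc)
    fix C assume C: "C \<subseteq> V" "\<not> (\<forall>j\<in>\<J>. real (card {e \<in> E j. \<phi> j e \<subseteq> C}) < \<epsilon> * N * D j)"
    then obtain j where j: "j \<in> \<J>" "\<epsilon> * N * D j \<le> real (card {e \<in> E j. \<phi> j e \<subseteq> C})"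
      by (auto simp: not_less)
    let ?E = "{e \<in> E j. \<phi> j e \<subseteq> C}"
    have Hj: "hypergraph V (E j) (\<phi> j) (s j) (D j) (B j)" using H[OF j(1)] by blast
    have fE: "finite (E j)" using Hj by (simp add: hypergraph_def)
    have "hypergraph C ?E (\<phi> j) (s j) (D j) (B j)"
      unfolding hypergraph_def
    proof (intro conjI ballI impI)
      show "finite C" using C(1) V finite_subset by blast
      show "finite ?E" using fE by simp
      show "\<phi> j e \<subseteq> C" "card (\<phi> j e) = s j" if "e \<in> ?E" for e
        using that Hj by (auto simp: hypergraph_def)
      fix u assume u: "u \<in> C"
      have "card (star ?E (\<phi> j) u) \<le> card (star (E j) (\<phi> j) u)"
        using fE by (intro card_mono) (auto simp: star_def)
      moreover have "real (card (star (E j) (\<phi> j) u)) \<le> D j" using Hj u C(1) by (auto simp: hypergraph_def)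
      ultimately show "real (card (star ?E (\<phi> j) u)) \<le> D j" by linarith
      fix w assume w: "w \<in> C" "u \<noteq> w"
      have "card (star ?E (\<phi> j) u \<inter> star ?E (\<phi> j) w) \<le> card (star (E j) (\<phi> j) u \<inter> star (E j) (\<phi> j) w)"
        using fE by (intro card_mono) (auto simp: star_def)
      moreover have "real (card (star (E j) (\<phi> j) u \<inter> star (E j) (\<phi> j) w)) \<le> B j"
        using Hj subsetD[OF C(1) u] subsetD[OF C(1) w(1)] w(2) by (simp add: hypergraph_def)
      ultimately show "real (card (star ?E (\<phi> j) u \<inter> star ?E (\<phi> j) w)) \<le> B j" by linarith
    qed
    moreover have "real (card C) \<le> N" using card_mono[OF V C(1)] N(2) by linarith
    ultimately have "has_containers C (edge_free ?E (\<phi> j))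
        (\<lambda>C'. real (card C') + \<delta> * N \<le> real (card C)) ((N + 1) ^ (m * q))"
      using H[OF j(1)] j(2) N(1) q by (intro round) auto
    then show "has_containers C (\<lambda>I. \<forall>j\<in>\<J>. edge_free (E j) (\<phi> j) I)
        (\<lambda>C'. real (card C') + \<delta> * N \<le> real (card C)) ((N + 1) ^ (m * q))"
      by (rule has_containers_mono) (use j(1) in \<open>auto simp: edge_free_def\<close>)
  qed
  then show ?thesis using \<delta> by (intro exI[of _ \<delta>] conjI exI[of _ J]) blast+
qed

section \<open>Complete types over a finite language\<close>

lemma sat_map_qf: "sat M v (map_qf id f \<phi>) \<longleftrightarrow> sat M (v \<circ> f) \<phi>"
  by (induction \<phi>) (auto simp: comp_def)

text \<open>A complete type is realised somewhere, and by completeness it consists of all formulas true at the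
realising tuple. This reduces questions about membership in the type to questions about truth.\<close>

lemma complete_type_is_theory:
  assumes "complete_type L r p"
  obtains N :: "('f, nat) struc" and as where "is_struc L N" "length as = r" "set as \<subseteq> univ N"
    "p = {\<phi> \<in> formulas L {..<r}. sat N (\<lambda>i. as ! i) \<phi>}"
proof -
  obtain N :: "('f, nat) struc" and as where N: "is_struc L N" "length as = r" "realizes N as p"
    using assms unfolding complete_type_def by blast
  have "\<phi> \<in> p" if "\<phi> \<in> formulas L {..<r}" "sat N (\<lambda>i. as ! i) \<phi>" for \<phi>
  proof (rule ccontr)
    assume "\<phi> \<notin> p"
    then have "Neg \<phi> \<in> p" using assms that(1) unfolding complete_type_def by blast
    then show False using N(3) that(2) unfolding realizes_def by fastforce
  qed
  then have "p = {\<phi> \<in> formulas L {..<r}. sat N (\<lambda>i. as ! i) \<phi>}"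
    using assms N(3) unfolding complete_type_def realizes_def by blast
  then show thesis using that N unfolding realizes_def by blast
qed

lemma formulas_simps [simp]:
  "Eq s t \<in> formulas L X \<longleftrightarrow> s \<in> X \<and> t \<in> X"
  "Rel R ts \<in> formulas L X \<longleftrightarrow> R \<in> symb L \<and> length ts = arity L R \<and> set ts \<subseteq> X"
  "Neg \<phi> \<in> formulas L X \<longleftrightarrow> \<phi> \<in> formulas L X"
  "Conj \<phi> \<psi> \<in> formulas L X \<longleftrightarrow> \<phi> \<in> formulas L X \<and> \<psi> \<in> formulas L X"
  by (auto simp: formulas_def)

lemma complete_type_Neg: "complete_type L r p \<Longrightarrow> \<phi> \<in> formulas L {..<r} \<Longrightarrow> Neg \<phi> \<in> p \<longleftrightarrow> \<phi> \<notin> p"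
  by (erule complete_type_is_theory) simp

lemma complete_type_Conj:
  "complete_type L r p \<Longrightarrow> Conj \<phi> \<psi> \<in> formulas L {..<r} \<Longrightarrow> Conj \<phi> \<psi> \<in> p \<longleftrightarrow> \<phi> \<in> p \<and> \<psi> \<in> p"
  by (erule complete_type_is_theory) auto

lemma complete_type_refl: "complete_type L r p \<Longrightarrow> i < r \<Longrightarrow> Eq i i \<in> p"
  by (erule complete_type_is_theory) simp

definition atoms :: "'f lang \<Rightarrow> nat \<Rightarrow> ('f, nat) qf set" where
  "atoms L r = (\<lambda>(i, j). Eq i j) ` ({..<r} \<times> {..<r}) \<union>
     (\<Union>R\<in>symb L. Rel R ` {ts. set ts \<subseteq> {..<r} \<and> length ts = arity L R})"

lemma finite_atoms: "finite (symb L) \<Longrightarrow> finite (atoms L r)"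
  unfolding atoms_def by (intro finite_UnI finite_UN_I finite_imageI finite_lists_length_eq) auto

text \<open>There are infinitely many quantifier-free formulas, but only finitely many atoms over a finite
relational language; this makes the number of types finite.\<close>

lemma complete_type_determined_by_atoms:
  assumes "complete_type L r p" "complete_type L r p'" "p \<inter> atoms L r = p' \<inter> atoms L r"
  shows "p = p'"
proof -
  have "\<phi> \<in> formulas L {..<r} \<Longrightarrow> \<phi> \<in> p \<longleftrightarrow> \<phi> \<in> p'" for \<phi>
  proof (induction \<phi>)
    case (Eq i j)
    then have "Eq i j \<in> atoms L r" by (auto simp: atoms_def)
    then show ?case using assms(3) by blast
  next
    case (Rel R ts)
    then have "Rel R ts \<in> atoms L r" by (auto simp: atoms_def)
    then show ?case using assms(3) by blast
  next
    case (Neg \<phi>)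
    then show ?case using assms(1,2) by (simp add: complete_type_Neg)
  next
    case (Conj \<phi> \<psi>)
    then show ?case
      using complete_type_Conj[OF assms(1), of \<phi> \<psi>] complete_type_Conj[OF assms(2), of \<phi> \<psi>] by simp
  qed
  moreover have "p \<subseteq> formulas L {..<r}" "p' \<subseteq> formulas L {..<r}"
    using assms(1,2) by (auto simp: complete_type_def)
  ultimately show ?thesis by blast
qed

lemma finite_types:
  assumes "finite (symb L)"
  shows "finite (types L r)"
proof (rule finite_imageD)
  show "finite ((\<lambda>p. p \<inter> atoms L r) ` types L r)"
    by (rule finite_subset[of _ "Pow (atoms L r)"]) (auto simp: finite_atoms[OF assms])
  show "inj_on (\<lambda>p. p \<inter> atoms L r) (types L r)"
    by (rule inj_onI, rule complete_type_determined_by_atoms[of L r]) (simp_all add: types_def)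
qed

lemma consts_of_inst:
  assumes "p \<in> types L r" "length cs = r"
  shows "consts_of (inst p cs) = set cs"
proof
  have "p \<subseteq> formulas L {..<r}" using assms(1) by (auto simp: types_def complete_type_def)
  then show "consts_of (inst p cs) \<subseteq> set cs"
    using assms(2) by (fastforce simp: consts_of_def inst_def qf.set_map formulas_def)
  show "set cs \<subseteq> consts_of (inst p cs)"
  proof
    fix c assume "c \<in> set cs"
    then obtain i where i: "i < r" "c = cs ! i" using assms(2) by (metis in_set_conv_nth)
    have "Eq i i \<in> p" using assms(1) i(1) by (auto simp: types_def intro: complete_type_refl)
    then have "Eq c c \<in> inst p cs" unfolding inst_def i(2) by force
    then show "c \<in> consts_of (inst p cs)" unfolding consts_of_def by force
  qed
qed

lemma consts_of_S_types:
  assumes "P \<in> S_types L r C"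
  shows "finite (consts_of P)" "card (consts_of P) = r" "consts_of P \<subseteq> C"
  using assms by (auto simp: S_types_def tuples_def consts_of_inst distinct_card)

lemma S_types_restrict:
  assumes "P \<in> S_types L r C" "consts_of P \<subseteq> X"
  shows "P \<in> S_types L r X"
  using assms by (fastforce simp: S_types_def tuples_def consts_of_inst)

section \<open>Syntactic diagrams\<close>

text \<open>A complete type decides every relation among its constants, so any two interpretations that satisfy it
agree on these relations.\<close>

lemma sat_type_agree:
  assumes P: "P \<in> S_types L r C"
    and M: "\<And>\<phi>. \<phi> \<in> P \<Longrightarrow> sat M v \<phi>" and N: "\<And>\<phi>. \<phi> \<in> P \<Longrightarrow> sat N w \<phi>"
    and R: "R \<in> symb L" "length xs = arity L R" "set xs \<subseteq> consts_of P"
  shows "map v xs \<in> rel M R \<longleftrightarrow> map w xs \<in> rel N R"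
proof -
  obtain p cs where p: "p \<in> types L r" "P = inst p cs" "length cs = r"
    using P by (auto simp: S_types_def tuples_def)
  have "set xs \<subseteq> set cs" using R(3) p consts_of_inst by metis
  then have "\<forall>x\<in>set xs. \<exists>i<r. x = cs ! i" using p(3) by (metis in_set_conv_nth subsetD)
  then obtain g where g: "\<And>x. x \<in> set xs \<Longrightarrow> g x < r \<and> x = cs ! g x" by metis
  define ts where "ts = map g xs"
  have xs: "xs = map (\<lambda>i. cs ! i) ts" using g by (simp add: ts_def map_idI)
  have "Rel R ts \<in> formulas L {..<r}" using g R by (auto simp: ts_def)
  then have "Rel R ts \<in> p \<or> Neg (Rel R ts) \<in> p"
    using p(1) by (simp add: types_def complete_type_def)
  moreover have "map_qf id (\<lambda>i. cs ! i) (Rel R ts) = Rel R xs"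
    "map_qf id (\<lambda>i. cs ! i) (Neg (Rel R ts)) = Neg (Rel R xs)" by (simp_all add: xs)
  ultimately have "Rel R xs \<in> P \<or> Neg (Rel R xs) \<in> P"
    unfolding p(2) inst_def by (metis imageI)
  then show ?thesis using M N by force
qed

lemma sat_type_inj:
  assumes P: "P \<in> S_types L r C" and M: "\<And>\<phi>. \<phi> \<in> P \<Longrightarrow> sat M v \<phi>"
  shows "inj_on v (consts_of P)"
proof (rule inj_onI, rule ccontr)
  obtain p cs where p: "p \<in> types L r" "P = inst p cs" "length cs = r"
    using P by (auto simp: S_types_def tuples_def)
  fix x y assume xy: "x \<in> consts_of P" "y \<in> consts_of P" "v x = v y" "x \<noteq> y"
  obtain i j where ij: "i < r" "j < r" "x = cs ! i" "y = cs ! j"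
    using xy p consts_of_inst by (metis in_set_conv_nth)
  then have "Neg (Eq i j) \<in> p" using p(1) xy(4) by (auto simp: types_def proper_type_def)
  then have "map_qf id (\<lambda>i. cs ! i) (Neg (Eq i j)) \<in> P" unfolding p(2) inst_def by (rule imageI)
  then have "Neg (Eq x y) \<in> P" using ij by simp
  then show False using M xy(3) by force
qed

lemma obtain_superset_card:
  assumes "finite V" "X \<subseteq> V" "card X \<le> r" "r \<le> card V"
  obtains A where "X \<subseteq> A" "A \<subseteq> V" "card A = r"
proof -
  have "finite X" using assms finite_subset by blast
  have "r - card X \<le> card (V - X)" using assms \<open>finite X\<close> by (simp add: card_Diff_subset)
  then obtain Y where Y: "Y \<subseteq> V - X" "card Y = r - card X" "finite Y"
    by (rule obtain_subset_with_card_n)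
  then have "card (X \<union> Y) = r" using assms(3) \<open>finite X\<close> by (subst card_Un_disjoint) auto
  then show thesis using that[of "X \<union> Y"] Y assms(2) by blast
qed

text \<open>Up to \<open>r\<close> constants extend to a set of exactly \<open>r\<close> constants, to which the diagram assigns a type.\<close>

lemma diagram_covers:
  assumes D: "syntactic_diagram L r C l \<sigma>" and "X \<subseteq> V_set \<sigma>" "card X \<le> r" "r \<le> l"
  obtains P where "P \<in> \<sigma>" "P \<in> S_types L r C" "X \<subseteq> consts_of P"
proof -
  obtain A where A: "X \<subseteq> A" "A \<subseteq> V_set \<sigma>" "card A = r"
    using obtain_superset_card[of "V_set \<sigma>" X r] assms by (auto simp: syntactic_diagram_def)
  then have "card (Ch \<sigma> A) = 1" using D by (simp add: syntactic_diagram_def)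
  then obtain P where "P \<in> Ch \<sigma> A" by (metis card_1_singletonE insertI1)
  then have "P \<in> \<sigma>" "consts_of P = A" by (auto simp: Ch_def)
  moreover have "P \<in> S_types L r C" using D \<open>P \<in> \<sigma>\<close> by (auto simp: syntactic_diagram_def)
  ultimately show thesis using that A(1) by blast
qed

text \<open>Each member of a diagram involves \<open>r\<close> constants, so the empty diagram is the only one with fewer.\<close>

lemma diagram_vertices_nonempty:
  assumes D: "syntactic_diagram L r C l \<sigma>" and "\<sigma> \<noteq> {}"
  shows "r \<le> l"
proof -
  obtain P where P: "P \<in> \<sigma>" using assms(2) by blast
  then have "card (consts_of P) = r"
    using D consts_of_S_types(2)[of P L r C] by (auto simp: syntactic_diagram_def)
  moreover have "consts_of P \<subseteq> V_set \<sigma>" using P by (auto simp: V_set_def)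
  ultimately show ?thesis using D card_mono[of "V_set \<sigma>" "consts_of P"] by (simp add: syntactic_diagram_def)
qed

text \<open>This is where \<open>r \<ge> 2\<close> matters: any two constants occur in a common proper type, which contains the
formula saying that they are distinct.\<close>

lemma models_inj:
  assumes D: "syntactic_diagram L r C l \<sigma>" and N: "models N v \<sigma>" and "2 \<le> r"
  shows "inj_on v (V_set \<sigma>)"
proof (cases "\<sigma> = {}")
  case True
  then show ?thesis by (simp add: V_set_def)
next
  case False
  show ?thesis
  proof (rule inj_onI)
    fix x y assume xy: "x \<in> V_set \<sigma>" "y \<in> V_set \<sigma>" "v x = v y"
    have "card {x, y} \<le> r" using assms(3) by (simp add: card_insert_if)
    then obtain P where P: "P \<in> \<sigma>" "P \<in> S_types L r C" "{x, y} \<subseteq> consts_of P"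
      using diagram_covers[OF D, of "{x, y}"] xy diagram_vertices_nonempty[OF D False] by blast
    have "\<And>\<phi>. \<phi> \<in> P \<Longrightarrow> sat N v \<phi>" using N P(1) by (auto simp: models_def)
    from sat_type_inj[OF P(2) this] show "x = y" using xy(3) P(3) by (auto dest: inj_onD)
  qed
qed

lemma card_diagram:
  assumes D: "syntactic_diagram L r C l \<sigma>"
  shows "card \<sigma> = l choose r"
proof -
  have V: "finite (V_set \<sigma>)" "card (V_set \<sigma>) = l"
    and ch: "\<And>A. A \<subseteq> V_set \<sigma> \<Longrightarrow> card A = r \<Longrightarrow> card (Ch \<sigma> A) = 1"
    using D by (auto simp: syntactic_diagram_def)
  have sub: "consts_of P \<subseteq> V_set \<sigma>" "card (consts_of P) = r" if "P \<in> \<sigma>" for P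
  proof -
    show "consts_of P \<subseteq> V_set \<sigma>" using that by (auto simp: V_set_def)
    show "card (consts_of P) = r"
      using D that consts_of_S_types(2)[of P L r C] by (auto simp: syntactic_diagram_def)
  qed
  have "bij_betw consts_of \<sigma> {A. A \<subseteq> V_set \<sigma> \<and> card A = r}"
  proof (rule bij_betw_imageI)
    show "inj_on consts_of \<sigma>"
    proof (rule inj_onI)
      fix P P' assume P: "P \<in> \<sigma>" "P' \<in> \<sigma>" "consts_of P = consts_of P'"
      have "card (Ch \<sigma> (consts_of P)) = 1" using ch sub P(1) by blast
      moreover have "P \<in> Ch \<sigma> (consts_of P)" "P' \<in> Ch \<sigma> (consts_of P)" using P by (auto simp: Ch_def)
      ultimately show "P = P'" by (metis card_1_singletonE singletonD)
    qed
    show "consts_of ` \<sigma> = {A. A \<subseteq> V_set \<sigma> \<and> card A = r}"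
    proof (rule equalityI; rule subsetI)
      fix A assume "A \<in> consts_of ` \<sigma>"
      then show "A \<in> {A. A \<subseteq> V_set \<sigma> \<and> card A = r}" using sub by blast
    next
      fix A assume "A \<in> {A. A \<subseteq> V_set \<sigma> \<and> card A = r}"
      then have "card (Ch \<sigma> A) = 1" using ch by blast
      then obtain P where "P \<in> Ch \<sigma> A" by (metis card_1_singletonE insertI1)
      then show "A \<in> consts_of ` \<sigma>" by (auto simp: Ch_def)
    qed
  qed
  then have "card \<sigma> = card {A. A \<subseteq> V_set \<sigma> \<and> card A = r}" by (rule bij_betw_same_card)
  then show ?thesis using n_subsets[OF V(1), of r] V(2) by simp
qed

text \<open>A diagram contains a single type for each set of \<open>r\<close> constants, so two distinct types in it have
distinct sets of constants. This is the source of the gain in codegrees.\<close>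

lemma distinct_types_span_more_constants:
  assumes D: "syntactic_diagram L r C l \<sigma>" and P: "P \<in> \<sigma>" "P' \<in> \<sigma>" "P \<noteq> P'"
  shows "r + 1 \<le> card (consts_of P \<union> consts_of P')"
proof -
  have S: "P \<in> S_types L r C" "P' \<in> S_types L r C" using D P by (auto simp: syntactic_diagram_def)
  note c = consts_of_S_types[OF S(1)] consts_of_S_types[OF S(2)]
  have "consts_of P \<noteq> consts_of P'"
  proof
    assume eq: "consts_of P = consts_of P'"
    have "consts_of P \<subseteq> V_set \<sigma>" using P by (auto simp: V_set_def)
    then have "card (Ch \<sigma> (consts_of P)) = 1" using D c(2) by (simp add: syntactic_diagram_def)
    moreover have "P \<in> Ch \<sigma> (consts_of P)" "P' \<in> Ch \<sigma> (consts_of P)" using P eq by (auto simp: Ch_def)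
    ultimately show False using P(3) by (metis card_1_singletonE singletonD)
  qed
  then have "consts_of P \<subset> consts_of P \<union> consts_of P'"
    using c by (metis card_subset_eq psubsetI sup.cobounded1 sup.orderE sup_commute)
  then have "card (consts_of P) < card (consts_of P \<union> consts_of P')"
    using c by (intro psubset_card_mono) auto
  then show ?thesis using c(2) by simp
qed

section \<open>Counting diagrams\<close>

lemma card_tuples: "finite X \<Longrightarrow> finite (tuples r X) \<and> card (tuples r X) \<le> card X ^ r"
proof -
  assume X: "finite X"
  have sub: "tuples r X \<subseteq> {xs. set xs \<subseteq> X \<and> length xs = r}" by (auto simp: tuples_def)
  show ?thesis
    using card_mono[OF finite_lists_length_eq[OF X] sub] finite_subset[OF sub finite_lists_length_eq[OF X]]
    by (simp add: card_lists_length_eq[OF X])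
qed

lemma card_S_types:
  assumes L: "finite (symb L)" and X: "finite X"
  shows "finite (S_types L r X)" "card (S_types L r X) \<le> card (types L r) * card X ^ r"
proof -
  have eq: "S_types L r X = (\<lambda>(p, cs). inst p cs) ` (types L r \<times> tuples r X)"
    by (auto simp: S_types_def)
  have fin: "finite (types L r \<times> tuples r X)" using finite_types[OF L] card_tuples[OF X] by blast
  then show "finite (S_types L r X)" unfolding eq by blast
  have "card (S_types L r X) \<le> card (types L r \<times> tuples r X)"
    unfolding eq by (rule card_image_le[OF fin])
  also have "\<dots> \<le> card (types L r) * card X ^ r"
    using card_tuples[OF X, of r] by (simp add: card_cartesian_product)
  finally show "card (S_types L r X) \<le> card (types L r) * card X ^ r" .
qed

lemma card_diagrams_on:
  assumes L: "finite (symb L)" and X: "finite X" "card X = l"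
  shows "finite {\<sigma>. syntactic_diagram L r W l \<sigma> \<and> V_set \<sigma> = X}" 
    "card {\<sigma>. syntactic_diagram L r W l \<sigma> \<and> V_set \<sigma> = X} \<le> 2 ^ (card (types L r) * l ^ r)"
proof -
  let ?S = "{\<sigma>. syntactic_diagram L r W l \<sigma> \<and> V_set \<sigma> = X}"
  note S = card_S_types[OF L X(1), of r]
  have sub: "?S \<subseteq> Pow (S_types L r X)"
  proof safe
    fix \<sigma> P assume "syntactic_diagram L r W l \<sigma>" "X = V_set \<sigma>" "P \<in> \<sigma>"
    then have "P \<in> S_types L r W" "consts_of P \<subseteq> V_set \<sigma>"
      by (auto simp: syntactic_diagram_def V_set_def)
    then show "P \<in> S_types L r (V_set \<sigma>)" by (rule S_types_restrict)
  qed
  then show "finite ?S" using S(1) finite_subset by blast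
  have "card ?S \<le> card (Pow (S_types L r X))"
    by (rule card_mono[OF _ sub]) (use S(1) in simp)
  also have "\<dots> = 2 ^ card (S_types L r X)" by (rule card_Pow[OF S(1)])
  also have "\<dots> \<le> 2 ^ (card (types L r) * l ^ r)"
    by (rule power_increasing) (use S(2) X(2) in auto)
  finally show "card ?S \<le> 2 ^ (card (types L r) * l ^ r)" .
qed

lemma card_supersets:
  assumes W: "finite W" "card W = n" and A: "A \<subseteq> W"
  shows "finite {X. A \<subseteq> X \<and> X \<subseteq> W \<and> card X = l}"
    "card {X. A \<subseteq> X \<and> X \<subseteq> W \<and> card X = l} \<le> n ^ (l - card A)"
proof -
  let ?S = "{X. A \<subseteq> X \<and> X \<subseteq> W \<and> card X = l}"
  let ?T = "{Y. Y \<subseteq> W \<and> card Y = l - card A}"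
  show "finite ?S" by (rule finite_subset[of _ "Pow W"]) (use W in auto)
  have finA: "finite A" using A W finite_subset by blast
  have "card ?S \<le> card ?T"
  proof (rule card_inj_on_le[of "\<lambda>X. X - A"])
    show "inj_on (\<lambda>X. X - A) ?S" by (auto simp: inj_on_def)
    show "(\<lambda>X. X - A) ` ?S \<subseteq> ?T" using finA by (auto simp: card_Diff_subset)
    show "finite ?T" by (rule finite_subset[of _ "Pow W"]) (use W in auto)
  qed
  also have "\<dots> = n choose (l - card A)" using n_subsets[OF W(1)] W(2) by simp
  also have "\<dots> \<le> n ^ (l - card A)"
    by (cases "l - card A \<le> n") (auto intro: binomial_le_pow simp: binomial_eq_0)
  finally show "card ?S \<le> n ^ (l - card A)" .
qed

text \<open>A diagram is determined by its set of constants up to boundedly many possibilities, so the count is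
that of the sets of \<open>l\<close> constants extending \<open>A\<close>, up to a constant factor.\<close>

lemma card_diagrams_containing:
  assumes L: "finite (symb L)" and W: "finite W" "card W = n" and A: "A \<subseteq> W" and l: "l \<le> K"
  shows "finite {\<sigma>. syntactic_diagram L r W l \<sigma> \<and> A \<subseteq> V_set \<sigma>}"
    "card {\<sigma>. syntactic_diagram L r W l \<sigma> \<and> A \<subseteq> V_set \<sigma>}
      \<le> n ^ (l - card A) * 2 ^ (card (types L r) * K ^ r)"
proof -
  let ?X = "{X. A \<subseteq> X \<and> X \<subseteq> W \<and> card X = l}"
  let ?D = "\<lambda>X. {\<sigma>. syntactic_diagram L r W l \<sigma> \<and> V_set \<sigma> = X}"
  let ?c = "2 ^ (card (types L r) * K ^ r) :: nat"
  note X = card_supersets[OF W A, of l]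
  have eq: "{\<sigma>. syntactic_diagram L r W l \<sigma> \<and> A \<subseteq> V_set \<sigma>} = (\<Union>X\<in>?X. ?D X)"
  proof -
    have "V_set \<sigma> \<subseteq> W \<and> card (V_set \<sigma>) = l" if "syntactic_diagram L r W l \<sigma>" for \<sigma>
      using that consts_of_S_types(3) by (fastforce simp: syntactic_diagram_def V_set_def)
    then show ?thesis by blast
  qed
  have D: "finite (?D X) \<and> card (?D X) \<le> ?c" if "X \<in> ?X" for X
  proof -
    have fX: "finite X" "card X = l" using that W(1) finite_subset by auto
    have "(2::nat) ^ (card (types L r) * l ^ r) \<le> ?c"
      using l by (intro power_increasing mult_left_mono power_mono) auto
    then show ?thesis using card_diagrams_on[OF L fX, of r W] by linarith
  qed
  show "finite {\<sigma>. syntactic_diagram L r W l \<sigma> \<and> A \<subseteq> V_set \<sigma>}"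
    unfolding eq using X(1) D by (intro finite_UN_I) auto
  have "card (\<Union>X\<in>?X. ?D X) \<le> (\<Sum>X\<in>?X. card (?D X))" by (rule card_UN_le[OF X(1)])
  also have "\<dots> \<le> card ?X * ?c" using D sum_bounded_above[of ?X "\<lambda>X. card (?D X)" ?c] by simp
  also have "\<dots> \<le> n ^ (l - card A) * ?c" using X(2) by (rule mult_right_mono) simp
  finally show "card {\<sigma>. syntactic_diagram L r W l \<sigma> \<and> A \<subseteq> V_set \<sigma>} \<le> n ^ (l - card A) * ?c"
    unfolding eq .
qed

text \<open>The degree and codegree bounds count diagrams containing at least \<open>r\<close>, respectively at least \<open>r + 1\<close>,
given constants. For \<open>l = r\<close> a diagram has just one member and there are no codegrees.\<close>

lemma hypergraph_of_diagrams:
  fixes W :: "'w set" and L :: "'f lang"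
  assumes L: "finite (symb L)" and W: "finite W" "card W = n" and l: "r \<le> l" "l \<le> K"
    and V: "V \<subseteq> S_types L r W"
    and E: "\<And>\<sigma>. \<sigma> \<in> E \<Longrightarrow> syntactic_diagram L r W l \<sigma> \<and> \<sigma> \<subseteq> V"
  defines "c \<equiv> 2 ^ (card (types L r) * K ^ r) :: real"
  shows "hypergraph V E (\<lambda>\<sigma>. \<sigma>) (l choose r) (c * real n ^ (l - r))
    (if l = r then 0 else c * real n ^ (l - r - 1))"
proof -
  have finV: "finite V" using V card_S_types(1)[OF L W(1)] finite_subset by blast
  have "finite E" using finite_subset[of E "Pow V"] E finV by auto
  have VW: "consts_of P \<subseteq> W" "card (consts_of P) = r" if "P \<in> V" for P
    using consts_of_S_types that V by blast+
  have count: "real (card F) \<le> c * real n ^ (l - card A)"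
    if "A \<subseteq> W" "F \<subseteq> {\<sigma>. syntactic_diagram L r W l \<sigma> \<and> A \<subseteq> V_set \<sigma>}"
    for A and F :: "('f, 'w) qf set set set"
  proof -
    note C = card_diagrams_containing[OF L W that(1) l(2), of r]
    have "card F \<le> n ^ (l - card A) * 2 ^ (card (types L r) * K ^ r)"
      using card_mono[OF C(1) that(2)] C(2) by linarith
    then have "real (card F) \<le> real (n ^ (l - card A) * 2 ^ (card (types L r) * K ^ r))"
      by (rule of_nat_mono)
    then show ?thesis by (simp add: c_def mult.commute)
  qed
  have Vs: "consts_of P \<subseteq> V_set \<sigma>" if "P \<in> \<sigma>" for P and \<sigma> :: "('f, 'w) qf set set"
    using that by (auto simp: V_set_def)
  show ?thesis
    unfolding hypergraph_def
  proof (intro conjI ballI impI)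
    show "finite V" "finite E" by fact+
    show "\<sigma> \<subseteq> V" "card \<sigma> = l choose r" if "\<sigma> \<in> E" for \<sigma>
      using E[OF that] card_diagram by auto
    fix P assume P: "P \<in> V"
    have "star E (\<lambda>\<sigma>. \<sigma>) P \<subseteq> {\<sigma>. syntactic_diagram L r W l \<sigma> \<and> consts_of P \<subseteq> V_set \<sigma>}"
      using E by (auto simp: star_def V_set_def)
    from count[OF VW(1)[OF P] this] VW(2)[OF P]
    show "real (card (star E (\<lambda>\<sigma>. \<sigma>) P)) \<le> c * real n ^ (l - r)" by simp
    fix P' assume P': "P' \<in> V" "P \<noteq> P'"
    let ?A = "consts_of P \<union> consts_of P'" and ?F = "star E (\<lambda>\<sigma>. \<sigma>) P \<inter> star E (\<lambda>\<sigma>. \<sigma>) P'"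
    have sub: "?F \<subseteq> {\<sigma>. syntactic_diagram L r W l \<sigma> \<and> ?A \<subseteq> V_set \<sigma>}"
      using E by (auto simp: star_def V_set_def)
    show "real (card ?F) \<le> (if l = r then 0 else c * real n ^ (l - r - 1))"
    proof (cases "?F = {}")
      case True
      then show ?thesis by (simp add: c_def)
    next
      case False
      then obtain \<sigma> where \<sigma>: "\<sigma> \<in> E" "P \<in> \<sigma>" "P' \<in> \<sigma>" by (auto simp: star_def)
      have d: "syntactic_diagram L r W l \<sigma>" using E \<sigma>(1) by blast
      have r1: "r + 1 \<le> card ?A" using distinct_types_span_more_constants[OF d \<sigma>(2,3) P'(2)] .
      have "card ?A \<le> l"
        using d Vs[OF \<sigma>(2)] Vs[OF \<sigma>(3)] card_mono[of "V_set \<sigma>" ?A] by (simp add: syntactic_diagram_def)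
      then have "l \<noteq> r" using r1 by linarith
      have AW: "?A \<subseteq> W" using VW(1)[OF P] VW(1)[OF P'(1)] by blast
      have "?A \<noteq> {}" using r1 by auto
      then have "n \<noteq> 0" using AW W by auto
      then have "real n ^ (l - card ?A) \<le> real n ^ (l - r - 1)"
        using r1 by (intro power_increasing) auto
      then have "c * real n ^ (l - card ?A) \<le> c * real n ^ (l - r - 1)"
        by (intro mult_left_mono) (auto simp: c_def)
      then show ?thesis using count[OF AW sub] \<open>l \<noteq> r\<close> by simp
    qed
  qed
qed

section \<open>Diagrams of structures\<close>

definition restrict_struc :: "('f, 'a) struc \<Rightarrow> 'a set \<Rightarrow> ('f, 'a) struc" where
  "restrict_struc M X = \<lparr>univ = X, rel = (\<lambda>R. {xs \<in> rel M R. set xs \<subseteq> X})\<rparr>"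

definition image_struc :: "('a \<Rightarrow> 'b) \<Rightarrow> ('f, 'a) struc \<Rightarrow> ('f, 'b) struc" where
  "image_struc f M = \<lparr>univ = f ` univ M, rel = (\<lambda>R. map f ` rel M R)\<rparr>"

lemma restrict_struc_simps [simp]:
  "univ (restrict_struc M X) = X" "rel (restrict_struc M X) R = {xs \<in> rel M R. set xs \<subseteq> X}"
  by (simp_all add: restrict_struc_def)

lemma image_struc_simps [simp]:
  "univ (image_struc f M) = f ` univ M" "rel (image_struc f M) R = map f ` rel M R"
  by (simp_all add: image_struc_def)

lemma substruc_restrict_struc:
  assumes "is_struc L M" "X \<subseteq> univ M" "X \<noteq> {}"
  shows "substruc L (restrict_struc M X) M"
  using assms by (auto simp: substruc_def is_struc_def)

lemma is_struc_image_struc: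
  assumes "is_struc L M"
  shows "is_struc L (image_struc f M)"
  unfolding is_struc_def
proof (intro conjI ballI subsetI)
  show "univ (image_struc f M) \<noteq> {}" using assms by (simp add: is_struc_def)
  fix R ys assume R: "R \<in> symb L" "ys \<in> rel (image_struc f M) R"
  then obtain xs where xs: "xs \<in> rel M R" "ys = map f xs" by auto
  then have "length xs = arity L R" "set xs \<subseteq> univ M" using assms R(1) by (auto simp: is_struc_def)
  then show "ys \<in> {xs. length xs = arity L R \<and> set xs \<subseteq> univ (image_struc f M)}"
    using xs(2) by auto
qed

lemma map_mem_image_struc:
  assumes M: "is_struc L M" and f: "inj_on f (univ M)" and R: "R \<in> symb L" and xs: "set xs \<subseteq> univ M"
  shows "map f xs \<in> rel (image_struc f M) R \<longleftrightarrow> xs \<in> rel M R"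
proof
  assume "map f xs \<in> rel (image_struc f M) R"
  then obtain ys where ys: "ys \<in> rel M R" "map f xs = map f ys" by auto
  have "set ys \<subseteq> univ M" using M R ys(1) by (auto simp: is_struc_def)
  then have "inj_on f (set xs \<union> set ys)" using f xs by (meson Un_least inj_on_subset)
  then have "xs = ys" using ys(2) map_inj_on[of f xs ys] by auto
  then show "xs \<in> rel M R" using ys(1) by simp
qed auto

lemma sat_image_struc:
  assumes M: "is_struc L M" and f: "inj_on f (univ M)"
  shows "well_formed L \<phi> \<Longrightarrow> (\<And>x. x \<in> qf_terms \<phi> \<Longrightarrow> v x \<in> univ M \<and> w x = f (v x)) \<Longrightarrow>
    sat (image_struc f M) w \<phi> \<longleftrightarrow> sat M v \<phi>"
proof (induction \<phi>)
  case (Eq s t)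
  then show ?case using f by (auto dest: inj_onD)
next
  case (Rel R ts)
  then have "map w ts = map f (map v ts)" by auto
  moreover have "set (map v ts) \<subseteq> univ M" using Rel.prems(2) by auto
  ultimately show ?case
    using map_mem_image_struc[OF M f, of R "map v ts"] Rel.prems(1)
    by (simp only: sat.simps well_formed.simps)
qed auto

text \<open>A forbidden substructure of the image pulls back along the isomorphism.\<close>

lemma is_free_isomorphic:
  assumes M: "is_struc L M" and iso: "isomorphic L M N" and free: "is_free L \<F> M"
  shows "is_free L \<F> N"
  unfolding is_free_def
proof
  assume "\<exists>N0. substruc L N0 N \<and> (\<exists>A\<in>\<F>. isomorphic L N0 A)"
  then obtain N0 A where N0: "substruc L N0 N" and A: "A \<in> \<F>" "isomorphic L N0 A" by blast
  obtain f where f: "bij_betw f (univ M) (univ N)" and frel: "\<And>R xs. R \<in> symb L \<Longrightarrow>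
      length xs = arity L R \<Longrightarrow> set xs \<subseteq> univ M \<Longrightarrow> xs \<in> rel M R \<longleftrightarrow> map f xs \<in> rel N R"
    using iso unfolding isomorphic_def by blast
  obtain g where g: "bij_betw g (univ N0) (univ A)" and grel: "\<And>R xs. R \<in> symb L \<Longrightarrow>
      length xs = arity L R \<Longrightarrow> set xs \<subseteq> univ N0 \<Longrightarrow> xs \<in> rel N0 R \<longleftrightarrow> map g xs \<in> rel A R"
    using A(2) unfolding isomorphic_def by blast
  have sub: "univ N0 \<subseteq> univ N" "univ N0 \<noteq> {}"
    and N0rel: "\<And>R. R \<in> symb L \<Longrightarrow> rel N0 R = {xs \<in> rel N R. set xs \<subseteq> univ N0}"
    using N0 by (auto simp: substruc_def is_struc_def)
  define X where "X = {x \<in> univ M. f x \<in> univ N0}"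
  have fX: "f ` X = univ N0" using f sub(1) by (auto simp: X_def bij_betw_def)
  have "inj_on f X" using f by (auto simp: bij_betw_def X_def inj_on_def)
  then have "bij_betw f X (univ N0)" using fX by (simp add: bij_betw_def)
  then have "bij_betw (g \<circ> f) X (univ A)" using g by (rule bij_betw_trans)
  moreover have "xs \<in> rel (restrict_struc M X) R \<longleftrightarrow> map (g \<circ> f) xs \<in> rel A R"
    if R: "R \<in> symb L" "length xs = arity L R" "set xs \<subseteq> X" for R xs
  proof -
    have s: "set (map f xs) \<subseteq> univ N0" using R(3) fX by auto
    have "xs \<in> rel (restrict_struc M X) R \<longleftrightarrow> map f xs \<in> rel N R"
      using frel[of R xs] R by (auto simp: X_def)
    also have "\<dots> \<longleftrightarrow> map f xs \<in> rel N0 R" using N0rel[OF R(1)] s by simp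
    also have "\<dots> \<longleftrightarrow> map g (map f xs) \<in> rel A R" using R s by (intro grel) auto
    finally show ?thesis by simp
  qed
  ultimately have "isomorphic L (restrict_struc M X) A"
    unfolding isomorphic_def by (intro exI[of _ "g \<circ> f"]) simp
  moreover have "substruc L (restrict_struc M X) M"
    by (rule substruc_restrict_struc[OF M]) (use fX sub(2) in \<open>auto simp: X_def\<close>)
  ultimately show False using free A(1) unfolding is_free_def by blast
qed

lemma isomorphic_image_struc:
  assumes "is_struc L M" "inj_on f (univ M)"
  shows "isomorphic L M (image_struc f M)"
  unfolding isomorphic_def
  by (intro exI[of _ f]) (use assms map_mem_image_struc[OF assms] in \<open>auto simp: bij_betw_def\<close>)

lemma diagram_of_sat:
  assumes "P \<in> diagram_of L r M"
  shows "consts_of P \<subseteq> univ M" "\<And>\<phi>. \<phi> \<in> P \<Longrightarrow> well_formed L \<phi>" "\<And>\<phi>. \<phi> \<in> P \<Longrightarrow> sat M (\<lambda>x. x) \<phi>"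
proof -
  obtain p as where p: "P = inst p as" "p \<in> types L r" "as \<in> tuples r (univ M)" "realizes M as p"
    using assms by (auto simp: diagram_of_def)
  show "consts_of P \<subseteq> univ M" using p by (auto simp: consts_of_inst tuples_def)
  have wf: "well_formed L (map_qf id g \<phi>) \<longleftrightarrow> well_formed L \<phi>" for g and \<phi> :: "('a, nat) qf"
    by (induction \<phi>) auto
  show "well_formed L \<phi>" if "\<phi> \<in> P" for \<phi>
    using that p(1,2) wf by (auto simp: inst_def types_def complete_type_def formulas_def)
  show "sat M (\<lambda>x. x) \<phi>" if "\<phi> \<in> P" for \<phi>
    using that p(1,4) by (auto simp: inst_def realizes_def sat_map_qf comp_def)
qed

text \<open>If the diagram of \<open>M\<close> contains a diagram \<open>\<sigma>\<close> with \<open>l\<close> constants that \<open>A\<close> satisfies via \<open>v\<close>, where \<open>A\<close>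
has \<open>l\<close> elements, then \<open>v\<close> is a bijection from the constants onto \<open>A\<close>. Every tuple of a relation has at
most \<open>r\<close> entries and is therefore covered by one type of \<open>\<sigma>\<close>, which \<open>M\<close> and \<open>A\<close> both satisfy; so \<open>v\<close>
is an isomorphism from a substructure of \<open>M\<close> to \<open>A\<close>.\<close>

lemma diagram_of_free_avoids:
  assumes M: "is_struc L M" "is_free L \<F> M"
    and D: "syntactic_diagram L r C l \<sigma>" "\<sigma> \<subseteq> diagram_of L r M"
    and A: "A \<in> \<F>" "finite (univ A)" "card (univ A) = l" "models A v \<sigma>"
    and r: "2 \<le> r" "r \<le> l" and ar: "\<And>R. R \<in> symb L \<Longrightarrow> arity L R \<le> r"
  shows False
proof -
  define X where "X = V_set \<sigma>"
  have X: "finite X" "card X = l" using D(1) by (auto simp: X_def syntactic_diagram_def)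
  have XM: "X \<subseteq> univ M" using D(2) diagram_of_sat(1) by (fastforce simp: X_def V_set_def)
  have inj: "inj_on v X" unfolding X_def by (rule models_inj[OF D(1) A(4) r(1)])
  have "v ` X = univ A"
    using A X inj by (intro card_subset_eq) (auto simp: models_def X_def card_image)
  then have bij: "bij_betw v X (univ A)" using inj by (simp add: bij_betw_def)
  have "xs \<in> rel (restrict_struc M X) R \<longleftrightarrow> map v xs \<in> rel A R"
    if R: "R \<in> symb L" "length xs = arity L R" "set xs \<subseteq> X" for R xs
  proof -
    have "card (set xs) \<le> r" using card_length[of xs] R(2) ar[OF R(1)] by linarith
    then obtain P where P: "P \<in> \<sigma>" "P \<in> S_types L r C" "set xs \<subseteq> consts_of P"
      using diagram_covers[OF D(1), of "set xs"] R(3) r(2) unfolding X_def by blast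
    have "map (\<lambda>x. x) xs \<in> rel M R \<longleftrightarrow> map v xs \<in> rel A R"
    proof (rule sat_type_agree[OF P(2) _ _ R(1,2) P(3)])
      show "sat M (\<lambda>x. x) \<phi>" if "\<phi> \<in> P" for \<phi>
        by (rule diagram_of_sat(3)[OF _ that]) (use P(1) D(2) in blast)
      show "sat A v \<phi>" if "\<phi> \<in> P" for \<phi> using A(4) P(1) that by (auto simp: models_def)
    qed
    then show ?thesis using R(3) by simp
  qed
  then have "isomorphic L (restrict_struc M X) A"
    unfolding isomorphic_def using bij by (intro exI[of _ v]) simp
  moreover have "substruc L (restrict_struc M X) M"
    by (rule substruc_restrict_struc[OF M(1) XM]) (use X r in auto)
  ultimately show False using M(2) A(1) unfolding is_free_def by blast
qed

text \<open>\<open>M\<close> itself satisfies \<open>\<sigma>\<close>, up to a copy of \<open>M\<close> on natural numbers.\<close>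

lemma diagram_of_satisfiable:
  assumes M: "is_struc L M" "finite (univ M)" and "\<sigma> \<subseteq> diagram_of L r M"
  shows "satisfiable L \<sigma>"
proof -
  obtain f :: "_ \<Rightarrow> nat" where f: "inj_on f (univ M)" using finite_imp_inj_to_nat_seg[OF M(2)] by blast
  have "models (image_struc f M) f \<sigma>"
    unfolding models_def
  proof (intro conjI ballI)
    show "f ` V_set \<sigma> \<subseteq> univ (image_struc f M)"
      using assms(3) diagram_of_sat(1) by (fastforce simp: V_set_def)
    fix P \<phi> assume P: "P \<in> \<sigma>" "\<phi> \<in> P"
    then have PM: "P \<in> diagram_of L r M" using assms(3) by blast
    have "qf_terms \<phi> \<subseteq> univ M" using diagram_of_sat(1)[OF PM] P(2) by (auto simp: consts_of_def)
    then have "sat (image_struc f M) f \<phi> \<longleftrightarrow> sat M (\<lambda>x. x) \<phi>"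
      using diagram_of_sat(2)[OF PM P(2)] by (intro sat_image_struc[OF M(1) f]) auto
    then show "sat (image_struc f M) f \<phi>" using diagram_of_sat(3)[OF PM P(2)] by simp
  qed
  then show ?thesis using is_struc_image_struc[OF M(1)] unfolding satisfiable_def by blast
qed

lemma diagram_of_subset_S_types_in:
  assumes M: "is_struc L M" "finite (univ M)" "is_free L \<F> M"
  shows "diagram_of L r M \<subseteq> S_types_in L r (univ M) (Forb L \<F> :: ('f, nat) struc set)"
proof
  fix P assume "P \<in> diagram_of L r M"
  then obtain p as where p: "P = inst p as" "p \<in> types L r" "as \<in> tuples r (univ M)" "realizes M as p"
    by (auto simp: diagram_of_def)
  obtain f :: "_ \<Rightarrow> nat" where f: "inj_on f (univ M)" using finite_imp_inj_to_nat_seg[OF M(2)] by blast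
  let ?N = "image_struc f M"
  have "?N \<in> Forb L \<F>"
    using is_struc_image_struc[OF M(1)] M(2)
      is_free_isomorphic[OF M(1) isomorphic_image_struc[OF M(1) f] M(3)]
    by (simp add: Forb_def)
  moreover have "realizes ?N (map f as) p"
    unfolding realizes_def
  proof (intro conjI ballI)
    show "set (map f as) \<subseteq> univ ?N" using p(4) by (auto simp: realizes_def)
    fix \<phi> assume \<phi>: "\<phi> \<in> p"
    have wf: "well_formed L \<phi>" "qf_terms \<phi> \<subseteq> {..<r}"
      using p(2) \<phi> by (auto simp: types_def complete_type_def formulas_def)
    have "length as = r" "set as \<subseteq> univ M" using p(3) by (auto simp: tuples_def)
    then have "sat ?N (\<lambda>i. map f as ! i) \<phi> \<longleftrightarrow> sat M (\<lambda>i. as ! i) \<phi>"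
      using wf by (intro sat_image_struc[OF M(1) f]) (auto simp: subset_iff)
    then show "sat ?N (\<lambda>i. map f as ! i) \<phi>" using p(4) \<phi> by (simp add: realizes_def)
  qed
  moreover have "length (map f as) = r" using p(3) by (simp add: tuples_def)
  ultimately have "p \<in> types_in L r (Forb L \<F> :: ('f, nat) struc set)"
    using p(2) unfolding types_in_def by blast
  then show "P \<in> S_types_in L r (univ M) (Forb L \<F> :: ('f, nat) struc set)"
    using p(1,3) unfolding S_types_in_def by blast
qed

section \<open>Containers for structures\<close>

lemma power_le_binomial:
  assumes "1 \<le> l" "l \<le> K" "K \<le> n"
  shows "real n ^ l \<le> real K ^ K * real (n choose l)"
proof -
  have "(real n / real l) ^ l \<le> real (n choose l)"
    using assms by (intro binomial_ge_n_over_k_pow_k) auto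
  then have "real n ^ l \<le> real l ^ l * real (n choose l)"
    using assms(1) by (simp add: power_divide divide_le_eq mult.commute)
  moreover have "real l ^ l \<le> real K ^ K"
  proof -
    have "real l ^ l \<le> real K ^ l" using assms(2) by (intro power_mono) auto
    also have "\<dots> \<le> real K ^ K" using assms by (intro power_increasing) auto
    finally show ?thesis .
  qed
  ultimately show ?thesis using mult_right_mono[of "real l ^ l" "real K ^ K" "real (n choose l)"] by linarith
qed

lemma card_small_diagrams:
  assumes L: "finite (symb L)" and W: "finite W" "card W = n" and n: "1 \<le> n" and l: "l \<le> K"
  shows "finite {\<sigma>. \<exists>j<l. syntactic_diagram L r W j \<sigma>}"
    "card {\<sigma>. \<exists>j<l. syntactic_diagram L r W j \<sigma>} \<le> l * (n ^ (l - 1) * 2 ^ (card (types L r) * K ^ r))"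
proof -
  let ?D = "\<lambda>j. {\<sigma>. syntactic_diagram L r W j \<sigma>}"
  let ?b = "n ^ (l - 1) * 2 ^ (card (types L r) * K ^ r)"
  have eq: "{\<sigma>. \<exists>j<l. syntactic_diagram L r W j \<sigma>} = (\<Union>j\<in>{..<l}. ?D j)" by blast
  have D: "finite (?D j) \<and> card (?D j) \<le> ?b" if "j < l" for j
  proof -
    have jK: "j \<le> K" using that l by simp
    have "n ^ j \<le> n ^ (l - 1)" using n that by (intro power_increasing) auto
    then have "n ^ j * 2 ^ (card (types L r) * K ^ r) \<le> ?b" by (rule mult_right_mono) simp
    moreover have "finite (?D j) \<and> card (?D j) \<le> n ^ j * 2 ^ (card (types L r) * K ^ r)"
      using card_diagrams_containing[OF L W empty_subsetI jK, of r] by simp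
    ultimately show ?thesis by linarith
  qed
  show "finite {\<sigma>. \<exists>j<l. syntactic_diagram L r W j \<sigma>}" unfolding eq using D by blast
  have "card (\<Union>j\<in>{..<l}. ?D j) \<le> (\<Sum>j\<in>{..<l}. card (?D j))" by (rule card_UN_le) simp
  also have "\<dots> \<le> l * ?b" using sum_bounded_above[of "{..<l}" "\<lambda>j. card (?D j)" ?b] D by simp
  finally show "card {\<sigma>. \<exists>j<l. syntactic_diagram L r W j \<sigma>} \<le> l * ?b" unfolding eq .
qed

lemma Diag_tp_cases:
  assumes "\<sigma> \<in> Diag_tp L r (of_size \<F> l) W" "2 \<le> r"
  shows "syntactic_diagram L r W (card (V_set \<sigma>)) \<sigma> \<and> card (V_set \<sigma>) \<le> l"
proof -
  have D: "syntactic_diagram L r W (card (V_set \<sigma>)) \<sigma>"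
    using assms(1) by (simp add: Diag_tp_def syntactic_type_diagram_def)
  obtain A v where A: "A \<in> of_size \<F> l" "models A v \<sigma>"
    using assms(1) by (auto simp: Diag_tp_def satisfiable_in_def)
  have "card (V_set \<sigma>) \<le> card (univ A)"
    using models_inj[OF D A(2) assms(2)] A by (intro card_inj_on_le[of v]) (auto simp: of_size_def models_def)
  then show ?thesis using D A(1) by (simp add: of_size_def)
qed

text \<open>The two kinds of edges in uniform notation, so that one application of the container theorem handles
all sizes \<open>l\<close> and both kinds at once.\<close>

definition copies :: "'f lang \<Rightarrow> nat \<Rightarrow> ('f, 'b) struc set \<Rightarrow> 'w set \<Rightarrow> ('f, 'w) qf set set \<Rightarrow>
    bool \<times> nat \<Rightarrow> ('f, 'w) qf set set set" where
  "copies L r \<F> W V = (\<lambda>(unsat :: bool, l).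
     {\<sigma>. syntactic_diagram L r W l \<sigma> \<and> \<sigma> \<subseteq> V \<and>
        (if unsat then \<not> satisfiable L \<sigma> else satisfiable_in (of_size \<F> l) \<sigma>)})"

lemma free_structure_avoids_copies:
  assumes M: "is_struc L M" "is_free L \<F> M" "finite (univ M)"
    and r: "2 \<le> r" "r \<le> l" and ar: "\<And>R. R \<in> symb L \<Longrightarrow> arity L R \<le> r"
  shows "edge_free (copies L r \<F> W V (unsat, l)) (\<lambda>\<sigma>. \<sigma>) (diagram_of L r M)"
  unfolding edge_free_def
proof (intro ballI notI)
  fix \<sigma> assume \<sigma>: "\<sigma> \<in> copies L r \<F> W V (unsat, l)" "\<sigma> \<subseteq> diagram_of L r M"
  show False
  proof (cases unsat)
    case True
    then show ?thesis using \<sigma> diagram_of_satisfiable[OF M(1,3) \<sigma>(2)] by (simp add: copies_def)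
  next
    case False
    then obtain A v where "A \<in> of_size \<F> l" "models A v \<sigma>" and D: "syntactic_diagram L r W l \<sigma>"
      using \<sigma>(1) by (auto simp: copies_def satisfiable_in_def)
    then show ?thesis
      using diagram_of_free_avoids[OF M(1,2) D \<sigma>(2) _ _ _ _ r ar] by (auto simp: of_size_def)
  qed
qed

text \<open>Half of the budget \<open>\<epsilon>\<close> is reserved for the diagrams with fewer than \<open>l\<close> constants (the empty diagram
among them), of which there are \<open>O(n ^ (l - 1))\<close>; the other half is for those with exactly \<open>l\<close>, which
are edges.\<close>

lemma few_diagrams_of_forbidden:
  fixes \<epsilon> c :: real and L :: "'f lang" and W :: "'w set"
  assumes L: "finite (symb L)" and W: "finite W" "card W = n" and "2 \<le> r" "1 \<le> l" "l \<le> K" "K \<le> n"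
    and c: "c = 2 ^ (card (types L r) * K ^ r)" and large: "2 * real K * c * real K ^ K \<le> \<epsilon> * real n"
    and few: "r \<le> l \<Longrightarrow> 
      real (card {\<sigma> \<in> copies L r \<F> W V (False, l). \<sigma> \<subseteq> C}) \<le> \<epsilon> / 2 * real (n choose l)"
    and C: "C \<subseteq> V" and "0 < \<epsilon>"
  shows "real (card (Diag_tp L r (of_size \<F> l) W \<inter> Span L r W C)) \<le> \<epsilon> * real (n choose l)"
proof -
  let ?S = "{\<sigma> :: ('f, 'w) qf set set. \<exists>j<l. syntactic_diagram L r W j \<sigma>}"
  let ?B = "{\<sigma> \<in> copies L r \<F> W V (False, l). \<sigma> \<subseteq> C}"
  have n: "1 \<le> n" using assms by linarith
  note S = card_small_diagrams[OF L W n assms(6), of r]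
  have sub: "Diag_tp L r (of_size \<F> l) W \<inter> Span L r W C \<subseteq> ?S \<union> ?B"
  proof
    fix \<sigma> assume \<sigma>: "\<sigma> \<in> Diag_tp L r (of_size \<F> l) W \<inter> Span L r W C"
    have D: "syntactic_diagram L r W (card (V_set \<sigma>)) \<sigma>" "card (V_set \<sigma>) \<le> l"
      using Diag_tp_cases[of \<sigma> L r \<F> l W] \<sigma> assms(4) by auto
    have "\<sigma> \<subseteq> C" using \<sigma> by (simp add: Span_def)
    moreover have "satisfiable_in (of_size \<F> l) \<sigma>" using \<sigma> by (simp add: Diag_tp_def)
    ultimately show "\<sigma> \<in> ?S \<union> ?B"
      using D C by (cases "card (V_set \<sigma>) < l") (auto simp: copies_def)
  qed
  have finB: "finite ?B"
  proof -
    have "?B \<subseteq> {\<sigma>. syntactic_diagram L r W l \<sigma> \<and> {} \<subseteq> V_set \<sigma>}" by (auto simp: copies_def)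
    then show ?thesis
      using card_diagrams_containing(1)[OF L W empty_subsetI order_refl] by (rule finite_subset)
  qed
  have "card (Diag_tp L r (of_size \<F> l) W \<inter> Span L r W C) \<le> card (?S \<union> ?B)"
    by (rule card_mono[OF _ sub]) (use S(1) finB in blast)
  also have "\<dots> \<le> card ?S + card ?B" by (rule card_Un_le)
  finally have total: "real (card (Diag_tp L r (of_size \<F> l) W \<inter> Span L r W C)) \<le>
      real (card ?S) + real (card ?B)" by linarith
  have "real (card ?S) \<le> real (l * (n ^ (l - 1) * 2 ^ (card (types L r) * K ^ r)))"
    using S(2) by (rule of_nat_mono)
  also have "\<dots> = real l * (real n ^ (l - 1) * c)" by (simp add: c)
  also have "\<dots> \<le> real K * (real n ^ (l - 1) * c)"
    using assms(6) by (intro mult_right_mono) (auto simp: c)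
  finally have "real (card ?S) * (2 * real K ^ K) \<le> real K * (real n ^ (l - 1) * c) * (2 * real K ^ K)"
    by (rule mult_right_mono) simp
  also have "\<dots> = (2 * real K * c * real K ^ K) * real n ^ (l - 1)" by (simp add: algebra_simps)
  also have "\<dots> \<le> \<epsilon> * real n * real n ^ (l - 1)" using large by (intro mult_right_mono) auto
  also have "\<dots> = \<epsilon> * real n ^ l" using assms(5) by (cases l) auto
  also have "\<dots> \<le> \<epsilon> * (real K ^ K * real (n choose l))"
    using power_le_binomial[OF assms(5-7)] \<open>0 < \<epsilon>\<close> by (intro mult_left_mono) auto
  also have "\<dots> = (\<epsilon> / 2 * real (n choose l)) * (2 * real K ^ K)" by simp
  finally have small: "real (card ?S) \<le> \<epsilon> / 2 * real (n choose l)"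
    using assms(5,6) by (simp only: mult_le_cancel_right) (auto simp: zero_less_power)
  have big: "real (card ?B) \<le> \<epsilon> / 2 * real (n choose l)"
  proof (cases "r \<le> l")
    case True
    then show ?thesis by (rule few)
  next
    case False
    have "?B = {}"
    proof (rule ccontr)
      assume "?B \<noteq> {}"
      then obtain \<sigma> where d: "syntactic_diagram L r W l \<sigma>" by (auto simp: copies_def)
      then have "\<sigma> \<noteq> {}" using assms(5) by (auto simp: syntactic_diagram_def V_set_def)
      then show False using diagram_vertices_nonempty[OF d] False by simp
    qed
    then have "real (card ?B) = 0" by (simp only: card.empty of_nat_0)
    then show ?thesis using \<open>0 < \<epsilon>\<close> by simp
  qed
  show ?thesis using total small big by linarith
qed

lemma few_unsatisfiable_diagrams:
  fixes \<epsilon> :: real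
  assumes L: "finite (symb L)" and W: "finite W" and C: "C \<subseteq> V"
    and few: "real (card {\<sigma> \<in> copies L r \<F> W V (True, l). \<sigma> \<subseteq> C}) \<le> b"
  shows "real (card (Err L r l W \<inter> Span L r W C)) \<le> b"
proof -
  let ?B = "{\<sigma> \<in> copies L r \<F> W V (True, l). \<sigma> \<subseteq> C}"
  have "?B \<subseteq> {\<sigma>. syntactic_diagram L r W l \<sigma> \<and> {} \<subseteq> V_set \<sigma>}" by (auto simp: copies_def)
  then have "finite ?B"
    using card_diagrams_containing(1)[OF L W refl empty_subsetI order_refl] by (rule finite_subset)
  moreover have "Err L r l W \<inter> Span L r W C \<subseteq> ?B"
    using C by (auto simp: Err_def Span_def copies_def)
  ultimately have "card (Err L r l W \<inter> Span L r W C) \<le> card ?B" by (rule card_mono)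
  then show ?thesis using few by linarith
qed

text \<open>Codegrees are smaller than degrees by the factor \<open>1 / n\<close>, and the container theorem asks for
\<open>(q / N) ^ s\<close>. With \<open>q / N \<ge> n powr (- 1 / m)\<close> this holds for every uniformity \<open>s \<le> m\<close>, which explains
the exponent in the final bound.\<close>

lemma link_fraction_dominates_codegree:
  fixes T :: real
  assumes "1 \<le> n" "0 < T" "s \<le> m" "1 \<le> m" and q: "T * real n powr (real r - 1 / real m) \<le> real q"
  shows "1 / real n \<le> (real q / (T * real n ^ r)) ^ s"
proof -
  have n: "0 < real n" using assms(1) by simp
  have "real n powr (- 1 / real m) = T * real n powr (real r - 1 / real m) / (T * real n ^ r)"
    using n assms(2) by (simp add: powr_diff powr_realpow powr_minus field_simps)
  also have "\<dots> \<le> real q / (T * real n ^ r)" using q assms(2) by (intro divide_right_mono) auto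
  finally have x: "real n powr (- 1 / real m) \<le> real q / (T * real n ^ r)" .
  have "1 / real n = real n powr (-1)" using n by (simp add: powr_minus divide_inverse)
  also have "\<dots> \<le> real n powr (real s * (- 1 / real m))"
    using assms by (intro powr_mono) (auto simp: divide_le_eq)
  also have "\<dots> = (real n powr (- 1 / real m)) ^ s"
    using n by (simp add: powr_realpow[symmetric] powr_powr mult.commute)
  also have "\<dots> \<le> (real q / (T * real n ^ r)) ^ s" using x by (intro power_mono) auto
  finally show ?thesis .
qed

lemma ln_container_count:
  fixes T :: real
  assumes n: "2 * T \<le> real n" "1 \<le> T"
    and q: "real q \<le> 2 * T * real n powr (real r - 1 / real m)"
    and b: "real b \<le> (T * real n ^ r + 1) ^ (m * q * J)"
  shows "ln (real b) \<le> (2 * T * real m * (real J + 1) * (real r + 1)) *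
    real n powr (real r - 1 / real m) * ln (real n)"
proof -
  let ?p = "real n powr (real r - 1 / real m)"
  have n1: "1 < real n" using n by linarith
  have lnn: "0 \<le> ln (real n)" using n1 by simp
  show ?thesis
  proof (cases "b = 0")
    case True
    then show ?thesis using lnn n by simp
  next
    case False
    have nr: "1 \<le> real n ^ r" using n1 by (intro one_le_power) simp
    then have "1 \<le> T * real n ^ r" using n(2) mult_mono[of 1 T 1 "real n ^ r"] by simp
    then have "T * real n ^ r + 1 \<le> 2 * T * real n ^ r" by simp
    also have "\<dots> \<le> real n * real n ^ r" using n nr by (intro mult_right_mono) auto
    finally have N: "T * real n ^ r + 1 \<le> real n ^ (r + 1)" by simp
    have N0: "0 < T * real n ^ r + 1" using \<open>1 \<le> T * real n ^ r\<close> by linarith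
    have "ln (real b) \<le> ln ((T * real n ^ r + 1) ^ (m * q * J))"
      using b False N0 by (subst ln_le_cancel_iff) auto
    also have "\<dots> = real (m * q * J) * ln (T * real n ^ r + 1)" using N0 by (simp add: ln_realpow)
    also have "\<dots> \<le> real (m * q * J) * ((real r + 1) * ln (real n))"
    proof (rule mult_left_mono)
      have "ln (T * real n ^ r + 1) \<le> ln (real n ^ (r + 1))" using N N0 n1 by (subst ln_le_cancel_iff) auto
      then show "ln (T * real n ^ r + 1) \<le> (real r + 1) * ln (real n)"
        using n1 ln_realpow[of "real n" "r + 1"] by (simp add: add.commute)
    qed simp
    also have "\<dots> = real q * (real m * real J * (real r + 1) * ln (real n))" by simp
    also have "\<dots> \<le> (2 * T * ?p) * (real m * real J * (real r + 1) * ln (real n))"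
      using q lnn by (intro mult_right_mono) auto
    also have "\<dots> \<le> (2 * T * ?p) * (real m * (real J + 1) * (real r + 1) * ln (real n))"
      using lnn n by (intro mult_left_mono mult_right_mono) auto
    finally show ?thesis by (simp only: mult_ac)
  qed
qed


theorem theorem11:
  fixes r k :: nat
  assumes "2 \<le> r" and "r \<le> k"
  shows "\<exists>m::real. m > 1 \<and>
    (\<forall>(L :: 'f lang) (\<epsilon> :: real). rel_lang r L \<and> 0 < \<epsilon> \<and> \<epsilon> < 1 \<longrightarrow>
      (\<exists>c::real. c > 0 \<and>
        (\<forall>\<^sub>F n in sequentially.
          \<forall>\<F> :: ('f, 'b) struc set.
            (\<forall>A\<in>\<F>. is_struc L A \<and> finite (univ A) \<and> card (univ A) \<le> k) \<and>
            (Forb L \<F> :: ('f, nat) struc set) \<noteq> {} \<longrightarrow>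
            (\<forall>W :: 'w set. finite W \<and> card W = n \<longrightarrow>
              (\<exists>\<Sigma>. \<Sigma> \<subseteq> Pow (S_types_in L r W (Forb L \<F> :: ('f, nat) struc set)) \<and>
                (\<forall>M :: ('f, 'w) struc. is_struc L M \<and> univ M = W \<and> is_free L \<F> M \<longrightarrow>
                  (\<exists>\<sigma>\<in>\<Sigma>. diagram_of L r M \<subseteq> \<sigma>)) \<and>
                (\<forall>\<sigma>\<in>\<Sigma>.
                  (\<forall>l. 1 \<le> l \<and> l \<le> k \<longrightarrow>
                    real (card (Diag_tp L r (of_size \<F> l) W \<inter> Span L r W \<sigma>))
                      \<le> \<epsilon> * real (n choose l)) \<and>
                  (\<forall>l. r + 1 \<le> l \<and> l \<le> 2 * r \<longrightarrow>
                    real (card (Err L r l W \<inter> Span L r W \<sigma>)) \<le> \<epsilon> * real (n choose l))) \<and>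
                ln (real (card \<Sigma>)) \<le> c * real n powr (real r - 1 / m) * ln (real n))))))"
proof -
  define K where "K = k + 2 * r"
  \<comment> \<open>An upper bound for all uniformities, as the diagrams in question have at most \<open>k + 2 * r\<close> constants.\<close>
  define m where "m = K choose r"
  have rK: "r \<le> K" "1 \<le> K" using assms by (auto simp: K_def)
  have m_bound: "l choose r \<le> m" if "l \<le> K" for l
    unfolding m_def using that by (rule binomial_right_mono)
  have m1: "1 < m"
  proof -
    have "(r + 1) choose r \<le> m" by (rule m_bound) (use assms in \<open>simp add: K_def\<close>)
    then show ?thesis using assms(1) by simp
  qed
  show ?thesis
  proof (rule exI[of _ "real m"], intro conjI allI impI)
    show "1 < real m" using m1 by simp
    fix L :: "'f lang" and \<epsilon> :: real
    assume hyp: "rel_lang r L \<and> 0 < \<epsilon> \<and> \<epsilon> < 1"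
    then have \<epsilon>: "0 < \<epsilon>" and L: "finite (symb L)"
      and ar: "\<And>R. R \<in> symb L \<Longrightarrow> arity L R \<le> r"
      by (auto simp: rel_lang_def)
    \<comment> \<open>The summand 1 keeps T positive even if there are no types.\<close>
    define T where "T = real (card (types L r)) + 1"
    define c where "c = (2 :: real) ^ (card (types L r) * K ^ r)"
    \<comment> \<open>Chosen such that \<open>\<epsilon>' * N * D\<close> becomes \<open>\<epsilon> / 2 * (n ^ l / K ^ K)\<close>, at most half of what is allowed.\<close>
    define \<epsilon>' where "\<epsilon>' = \<epsilon> / 2 / (T * c * real K ^ K)"
    have T: "1 \<le> T" and c: "0 < c" and KK: "0 < real K ^ K" using rK by (auto simp: T_def c_def)
    then have \<epsilon>': "0 < \<epsilon>'" using \<epsilon> by (simp add: \<epsilon>'_def)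
    obtain \<delta> J where \<delta>: "0 < \<delta>" and containers:
      "\<forall>(V :: ('f, 'w) qf set set) \<J> (E :: bool \<times> nat \<Rightarrow> ('f, 'w) qf set set set) \<phi> s D B N q.
        finite V \<and> 0 < N \<and> real (card V) \<le> N \<and> 0 < q \<and> real q \<le> \<delta> * N \<and>
        (\<forall>j\<in>\<J>. 1 \<le> s j \<and> s j \<le> m \<and> hypergraph V (E j) (\<phi> j) (s j) (D j) (B j) \<and>
          0 < D j \<and> 0 \<le> B j \<and> B j \<le> D j * (real q / N) ^ s j) \<longrightarrow>
        has_containers V (\<lambda>I. \<forall>j\<in>\<J>. edge_free (E j) (\<phi> j) I)
          (\<lambda>C. \<forall>j\<in>\<J>. real (card {e \<in> E j. \<phi> j e \<subseteq> C}) < \<epsilon>' * N * D j) ((N + 1) ^ (m * q * J))"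
      using containers_for_hypergraphs[OF \<epsilon>', of m] by (elim exE conjE)
    define cc where "cc = 2 * T * real m * (real J + 1) * (real r + 1)"
    have cc: "0 < cc" using T m1 by (simp add: cc_def)
    have ev1: "\<forall>\<^sub>F n in sequentially. real n powr (- 1 / real m) < \<delta> / 2"
    proof (rule order_tendstoD(2))
      show "((\<lambda>n. real n powr (- 1 / real m)) \<longlongrightarrow> 0) sequentially"
        by (rule tendsto_neg_powr[OF _ filterlim_real_sequentially]) (use m1 in simp)
      show "0 < \<delta> / 2" using \<delta> by simp
    qed
    have ev2: "\<forall>\<^sub>F n in sequentially. K \<le> n \<and> 2 * T \<le> real n \<and> 2 * real K * c * real K ^ K / \<epsilon> \<le> real n"
      using eventually_ge_at_top[of K] eventually_ge_at_top[of "nat \<lceil>2 * T\<rceil>"]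
        eventually_ge_at_top[of "nat \<lceil>2 * real K * c * real K ^ K / \<epsilon>\<rceil>"]
      by eventually_elim (meson nat_ceiling_le_eq)
    show "\<exists>c'>0. \<forall>\<^sub>F n in sequentially.
          \<forall>\<F> :: ('f, 'b) struc set.
            (\<forall>A\<in>\<F>. is_struc L A \<and> finite (univ A) \<and> card (univ A) \<le> k) \<and>
            (Forb L \<F> :: ('f, nat) struc set) \<noteq> {} \<longrightarrow>
            (\<forall>W :: 'w set. finite W \<and> card W = n \<longrightarrow>
              (\<exists>\<Sigma>. \<Sigma> \<subseteq> Pow (S_types_in L r W (Forb L \<F> :: ('f, nat) struc set)) \<and>
                (\<forall>M :: ('f, 'w) struc. is_struc L M \<and> univ M = W \<and> is_free L \<F> M \<longrightarrow>
                  (\<exists>\<sigma>\<in>\<Sigma>. diagram_of L r M \<subseteq> \<sigma>)) \<and>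
                (\<forall>\<sigma>\<in>\<Sigma>.
                  (\<forall>l. 1 \<le> l \<and> l \<le> k \<longrightarrow>
                    real (card (Diag_tp L r (of_size \<F> l) W \<inter> Span L r W \<sigma>))
                      \<le> \<epsilon> * real (n choose l)) \<and>
                  (\<forall>l. r + 1 \<le> l \<and> l \<le> 2 * r \<longrightarrow>
                    real (card (Err L r l W \<inter> Span L r W \<sigma>)) \<le> \<epsilon> * real (n choose l))) \<and>
                ln (real (card \<Sigma>)) \<le> c' * real n powr (real r - 1 / real m) * ln (real n)))"
      (is "\<exists>c'>0. \<forall>\<^sub>F n in sequentially. ?main c' n")
    proof (intro exI[of _ cc] conjI cc)
      show "\<forall>\<^sub>F n in sequentially. ?main cc n"
        using ev1 ev2
      proof (eventually_elim, intro allI impI)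
        fix n and \<F> :: "('f, 'b) struc set" and W :: "'w set"
        assume n\<delta>: "real n powr (- 1 / real m) < \<delta> / 2"
          and n: "K \<le> n \<and> 2 * T \<le> real n \<and> 2 * real K * c * real K ^ K / \<epsilon> \<le> real n"
          and "finite W \<and> card W = n"
        then have W: "finite W" "card W = n" by auto
        have n1: "1 \<le> n" using n rK by linarith
        have large: "2 * real K * c * real K ^ K \<le> \<epsilon> * real n"
          using n \<epsilon> by (simp add: divide_le_eq mult.commute)
        let ?H = "Forb L \<F> :: ('f, nat) struc set"
        define V where "V = S_types_in L r W ?H"
        define N where "N = T * real n ^ r"
        define p where "p = real n powr (real r - 1 / real m)"
        define q where "q = nat \<lceil>T * p\<rceil>"
        have V: "V \<subseteq> S_types L r W" by (auto simp: V_def S_types_in_def S_types_def types_in_def)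
        note S = card_S_types[OF L W(1), of r]
        have finV: "finite V" using V S(1) finite_subset by blast
        have N: "0 < N" using T n1 by (simp add: N_def)
        have VN: "real (card V) \<le> N"
        proof -
          have "card V \<le> card (types L r) * n ^ r" using card_mono[OF S(1) V] S(2) W(2) by simp
          then have "real (card V) \<le> real (card (types L r) * n ^ r)" by (rule of_nat_mono)
          also have "\<dots> \<le> N" by (simp add: N_def T_def algebra_simps)
          finally show ?thesis .
        qed
        have p1: "1 \<le> p"
        proof -
          have "1 / real m \<le> 1" using m1 by (simp add: divide_le_eq)
          then have "0 \<le> real r - 1 / real m" using assms(1) by linarith
          then show ?thesis unfolding p_def using n1 by (intro ge_one_powr_ge_zero) simp_all
        qed
        then have Tp: "1 \<le> T * p" using T mult_mono[of 1 T 1 p] by simp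
        have q: "T * p \<le> real q" "real q \<le> 2 * T * p" "0 < q"
          using Tp by (auto simp: q_def real_nat_ceiling_ge) linarith+
        have q\<delta>: "real q \<le> \<delta> * N"
        proof -
          have "p = real n ^ r * real n powr (- 1 / real m)"
            using n1 by (simp add: p_def powr_diff powr_minus powr_realpow divide_inverse)
          also have "\<dots> \<le> real n ^ r * (\<delta> / 2)" using n\<delta> by (intro mult_left_mono) auto
          finally have "2 * T * p \<le> 2 * T * (real n ^ r * (\<delta> / 2))" using T by (intro mult_left_mono) auto
          then show ?thesis using q(2) by (simp add: N_def algebra_simps)
        qed
        define \<J> where "\<J> = {False} \<times> {r..k} \<union> {True} \<times> {r + 1..2 * r}"
        define D where "D = (\<lambda>(unsat :: bool, l). c * real n ^ (l - r))"
        define B where "B = (\<lambda>(unsat :: bool, l). if l = r then 0 else c * real n ^ (l - r - 1))"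
        have JK: "r \<le> l \<and> l \<le> K" if "(u, l) \<in> \<J>" for u l using that by (auto simp: \<J>_def K_def)
        have "has_containers V (\<lambda>I. \<forall>j\<in>\<J>. edge_free (copies L r \<F> W V j) (\<lambda>\<sigma>. \<sigma>) I)
            (\<lambda>C. \<forall>j\<in>\<J>. real (card {\<sigma> \<in> copies L r \<F> W V j. \<sigma> \<subseteq> C}) < \<epsilon>' * N * D j)
            ((N + 1) ^ (m * q * J))"
        proof (rule containers[rule_format, where s = "\<lambda>(u, l). l choose r" and \<phi> = "\<lambda>_ \<sigma>. \<sigma>" and B = B],
            intro conjI finV N VN q(3) q\<delta> ballI)
          fix j assume "j \<in> \<J>"
          moreover obtain u l where j: "j = (u, l)" by (cases j)
          ultimately have l: "r \<le> l" "l \<le> K" using JK by auto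
          show "1 \<le> (case j of (u, l) \<Rightarrow> l choose r)" using l by (simp add: j Suc_le_eq)
          show "(case j of (u, l) \<Rightarrow> l choose r) \<le> m" using l m_bound by (simp add: j)
          show "hypergraph V (copies L r \<F> W V j) (\<lambda>\<sigma>. \<sigma>) (case j of (u, l) \<Rightarrow> l choose r) (D j) (B j)"
            unfolding j D_def B_def prod.case c_def
            by (rule hypergraph_of_diagrams[OF L W l V]) (simp add: copies_def)
          show "0 < D j" "0 \<le> B j" using c n1 by (simp_all add: D_def B_def j)
          show "B j \<le> D j * (real q / N) ^ (case j of (u, l) \<Rightarrow> l choose r)"
          proof (cases "l = r")
            case True
            then show ?thesis using c N by (simp add: D_def B_def j)
          next
            case False
            have "1 / real n \<le> (real q / (T * real n ^ r)) ^ (l choose r)"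
              by (rule link_fraction_dominates_codegree[OF n1 _ m_bound[OF l(2)]])
                (use T m1 q(1) in \<open>auto simp: p_def\<close>)
            then have "D j * (1 / real n) \<le> D j * (real q / N) ^ (l choose r)"
              unfolding N_def using c by (intro mult_left_mono) (auto simp: D_def j)
            moreover have "l - r = Suc (l - r - 1)" using l(1) False by simp
            then have "real n ^ (l - r) = real n * real n ^ (l - r - 1)" by (metis power_Suc)
            then have "B j = D j * (1 / real n)" using False n1 by (simp add: D_def B_def j)
            ultimately show ?thesis by (simp add: j)
          qed
        qed
        then obtain \<Sigma> where \<Sigma>': "finite \<Sigma> \<and> real (card \<Sigma>) \<le> (N + 1) ^ (m * q * J) \<and>
            (\<forall>C\<in>\<Sigma>. C \<subseteq> V \<and> (\<forall>j\<in>\<J>. real (card {\<sigma> \<in> copies L r \<F> W V j. \<sigma> \<subseteq> C}) < \<epsilon>' * N * D j)) \<and>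
            (\<forall>I. I \<subseteq> V \<and> (\<forall>j\<in>\<J>. edge_free (copies L r \<F> W V j) (\<lambda>\<sigma>. \<sigma>) I) \<longrightarrow> (\<exists>C\<in>\<Sigma>. I \<subseteq> C))"
          unfolding has_containers_def by (elim exE)
        then have \<Sigma>: "real (card \<Sigma>) \<le> (N + 1) ^ (m * q * J)" "\<And>C. C \<in> \<Sigma> \<Longrightarrow> C \<subseteq> V"
          "\<And>C j. C \<in> \<Sigma> \<Longrightarrow> j \<in> \<J> \<Longrightarrow> real (card {\<sigma> \<in> copies L r \<F> W V j. \<sigma> \<subseteq> C}) < \<epsilon>' * N * D j"
          and cover: "\<And>I. I \<subseteq> V \<Longrightarrow> (\<And>j. j \<in> \<J> \<Longrightarrow> edge_free (copies L r \<F> W V j) (\<lambda>\<sigma>. \<sigma>) I) \<Longrightarrow>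
            \<exists>C\<in>\<Sigma>. I \<subseteq> C"
          by simp_all
        have few: "real (card {\<sigma> \<in> copies L r \<F> W V (u, l). \<sigma> \<subseteq> C}) \<le> \<epsilon> / 2 * real (n choose l)"
          if "C \<in> \<Sigma>" "(u, l) \<in> \<J>" for C u l
        proof -
          have l: "r \<le> l" "l \<le> K" using JK[OF that(2)] by auto
          then have "real n ^ l = real n ^ r * real n ^ (l - r)" by (simp add: power_add[symmetric])
          then have "\<epsilon>' * N * D (u, l) = \<epsilon> / 2 * (real n ^ l / real K ^ K)"
            using T c KK by (simp add: \<epsilon>'_def N_def D_def)
          also have "\<dots> \<le> \<epsilon> / 2 * real (n choose l)"
          proof -
            have "1 \<le> l" using l(1) assms(1) by simp
            then have "real n ^ l \<le> real K ^ K * real (n choose l)"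
              using l(2) n by (intro power_le_binomial) auto
            then have "real n ^ l / real K ^ K \<le> real (n choose l)"
              using KK by (simp add: divide_le_eq mult.commute)
            then show ?thesis using \<epsilon> by (intro mult_left_mono) auto
          qed
          finally show ?thesis using \<Sigma>(3)[OF that] by linarith
        qed
        show "\<exists>\<Sigma>. \<Sigma> \<subseteq> Pow (S_types_in L r W ?H) \<and>
                  (\<forall>M :: ('f, 'w) struc. is_struc L M \<and> univ M = W \<and> is_free L \<F> M \<longrightarrow>
                    (\<exists>\<sigma>\<in>\<Sigma>. diagram_of L r M \<subseteq> \<sigma>)) \<and>
                  (\<forall>\<sigma>\<in>\<Sigma>.
                    (\<forall>l. 1 \<le> l \<and> l \<le> k \<longrightarrow>
                      real (card (Diag_tp L r (of_size \<F> l) W \<inter> Span L r W \<sigma>))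
                        \<le> \<epsilon> * real (n choose l)) \<and>
                    (\<forall>l. r + 1 \<le> l \<and> l \<le> 2 * r \<longrightarrow>
                      real (card (Err L r l W \<inter> Span L r W \<sigma>)) \<le> \<epsilon> * real (n choose l))) \<and>
                  ln (real (card \<Sigma>)) \<le> cc * real n powr (real r - 1 / real m) * ln (real n)"
        proof (intro exI[of _ \<Sigma>] conjI allI impI ballI)
          show "\<Sigma> \<subseteq> Pow (S_types_in L r W ?H)" using \<Sigma>(2) by (auto simp: V_def)
          show "ln (real (card \<Sigma>)) \<le> cc * real n powr (real r - 1 / real m) * ln (real n)"
            unfolding cc_def by (rule ln_container_count[of T n q r m])
              (use n T m1 assms q \<Sigma>(1) in \<open>auto simp: p_def N_def\<close>)
        next
          fix M :: "('f, 'w) struc"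
          assume M: "is_struc L M \<and> univ M = W \<and> is_free L \<F> M"
          show "\<exists>\<sigma>\<in>\<Sigma>. diagram_of L r M \<subseteq> \<sigma>"
          proof (rule cover)
            show "diagram_of L r M \<subseteq> V"
              using diagram_of_subset_S_types_in[of L M \<F> r] M W unfolding V_def by auto
            fix j assume j: "j \<in> \<J>"
            then obtain u l where ul: "j = (u, l)" "r \<le> l" using JK by (cases j) auto
            show "edge_free (copies L r \<F> W V j) (\<lambda>\<sigma>. \<sigma>) (diagram_of L r M)"
              unfolding ul(1) by (rule free_structure_avoids_copies) (use M W assms ul ar in auto)
          qed
        next
          fix C l assume C: "C \<in> \<Sigma>" and l: "1 \<le> l \<and> l \<le> k"
          show "real (card (Diag_tp L r (of_size \<F> l) W \<inter> Span L r W C)) \<le> \<epsilon> * real (n choose l)"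
          proof (rule few_diagrams_of_forbidden[OF L W assms(1) _ _ _ c_def large _ \<Sigma>(2)[OF C] \<epsilon>])
            show "real (card {\<sigma> \<in> copies L r \<F> W V (False, l). \<sigma> \<subseteq> C}) \<le> \<epsilon> / 2 * real (n choose l)"
              if "r \<le> l" by (rule few[OF C]) (use that l in \<open>auto simp: \<J>_def\<close>)
          qed (use l n in \<open>auto simp: K_def\<close>)
        next
          fix C l assume C: "C \<in> \<Sigma>" and l: "r + 1 \<le> l \<and> l \<le> 2 * r"
          have "real (card {\<sigma> \<in> copies L r \<F> W V (True, l). \<sigma> \<subseteq> C}) \<le> \<epsilon> / 2 * real (n choose l)"
            by (rule few[OF C]) (use l in \<open>auto simp: \<J>_def\<close>)
          then have "real (card {\<sigma> \<in> copies L r \<F> W V (True, l). \<sigma> \<subseteq> C}) \<le> \<epsilon> * real (n choose l)"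
            using \<epsilon> mult_right_mono[of "\<epsilon> / 2" \<epsilon> "real (n choose l)"] by linarith
          then show "real (card (Err L r l W \<inter> Span L r W C)) \<le> \<epsilon> * real (n choose l)"
            by (rule few_unsatisfiable_diagrams[OF L W(1) \<Sigma>(2)[OF C]])
        qed
      qed
    qed
  qed
qed

end
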